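(* Let $(G,p,L)$ be a generic $\mathbb{Z}^d$-framework. Then the following are equivalent: (1) $(G,p,L)$ is fixed-lattice globally rigid; (2) $(G,p,L)$ has a fixed-lattice equilibrium stress $\omega$ with $\dim\ker\mathcal{L}(G,\omega)=1$.
   Context: Fix an integer $d\ge 1$. A $\mathbb{Z}^d$-gain graph $G=(V,E)$ consists of a finite nonempty vertex set $V$ and a finite set $E$ of edges, where an edge is an equivalence class of triples $(u,v,\gamma)\in V\times V\times\mathbb{Z}^d$ under the identification $(u,v,\gamma)\sim(v,u,-\gamma)$, and triples $(u,u,0)$ are not allowed. $\gamma$ is the gain of the edge; the edge is a loop if $u=v$. One representative of each edge is fixed; the notions below do not depend on this choice. A $\mathbb{Z}^d$-framework is a triple $(G,p,L)$ with $p:V\to\mathbb{R}^d$ and $L\in\mathbb{R}^{d\times d}$ an arbitrary real matrix (the lattice). Frameworks $(G,p,L)$ and $(G,q,L')$ are equivalent if $\|p(v)+L\gamma-p(u)\|=\|q(v)+L'\gamma-q(u)\|$ for all $(u,v,\gamma)\in E$, and congruent if there are an orthogonal $d\times d$ matrix $M$ and $x\in\mathbb{R}^d$ with $q(v)=Mp(v)+x$ for all $v\in V$ and $L'=ML$. $(G,p,L)$ is fixed-lattice globally rigid if every $\mathbb{Z}^d$-framework $(G,q,L)$ with the same lattice $L$ that is equivalent to $(G,p,L)$ is congruent to $(G,p,L)$. $(G,p,L)$ is generic if the $d|V|+d^2$ coordinates of $p$ and entries of $L$ are algebraically independent over $\mathbb{Q}$. A fixed-lattice equilibrium stress of $(G,p,L)$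 is $\omega:E\to\mathbb{R}$ such that for each $x\in V$, $\sum \omega(e)(p(x)+L\gamma-p(u))=\mathbf{0}$, the sum being over non-loop edges $e$ at $x$ written as $e=(u,x,\gamma)$. $I(G)$ is the $|E|\times|V|$ matrix whose row for a non-loop edge $(u,v,\gamma)$ has $-1$ in column $u$, $+1$ in column $v$ and $0$ elsewhere, and whose row for a loop is zero. $\mathcal{L}(G,\omega)=I(G)^\top\,\mathrm{diag}(\omega)\,I(G)$. *)

theory Defs
  imports "HOL-Analysis.Analysis" "HOL-Library.Poly_Mapping"
begin

text \<open>
  The vertex set is the (finite, nonempty) type \<open>'v\<close> and the dimension is \<open>d = CARD('d)\<close>.
\<close>

type_synonym ('v, 'd) triple = "'v \<times> 'v \<times> (int ^ 'd)"
type_synonym ('v, 'd) edge = "('v, 'd) triple set"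

definition gain_equiv :: "(('v, 'd::finite) triple \<times> ('v, 'd) triple) set" where
  "gain_equiv = {((u, v, \<gamma>), t) | u v \<gamma> t. t = (u, v, \<gamma>) \<or> t = (v, u, - \<gamma>)}"

lemma equiv_gain_equiv: "equiv UNIV (gain_equiv :: (('v, 'd::finite) triple \<times> _) set)"
  by (rule equivI) (auto simp: gain_equiv_def refl_on_def sym_def trans_def)

definition gain_graph :: "('v::finite, 'd::finite) edge set \<Rightarrow> bool" where
  "gain_graph E \<longleftrightarrow> finite E \<and> E \<subseteq> UNIV // gain_equiv \<and> (\<forall>e\<in>E. \<forall>u. (u, u, 0) \<notin> e)"

definition lattice_vec :: "real ^ 'd ^ 'd \<Rightarrow> int ^ 'd \<Rightarrow> real ^ 'd::finite" where
  "lattice_vec L \<gamma> = L *v (\<chi> i. real_of_int (\<gamma> $ i))"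

text \<open>
  Both triples of an edge impose the same condition, so all of them are quantified over.
\<close>

definition equivalent_frameworks ::
  "('v::finite, 'd::finite) edge set \<Rightarrow> ('v \<Rightarrow> real ^ 'd) \<Rightarrow> real ^ 'd ^ 'd
    \<Rightarrow> ('v \<Rightarrow> real ^ 'd) \<Rightarrow> real ^ 'd ^ 'd \<Rightarrow> bool" where
  "equivalent_frameworks E p L q L' \<longleftrightarrow>
    (\<forall>e\<in>E. \<forall>(u, v, \<gamma>)\<in>e.
      norm (p v + lattice_vec L \<gamma> - p u) = norm (q v + lattice_vec L' \<gamma> - q u))"

definition congruent_frameworks ::
  "('v::finite \<Rightarrow> real ^ 'd::finite) \<Rightarrow> real ^ 'd ^ 'd
    \<Rightarrow> ('v \<Rightarrow> real ^ 'd) \<Rightarrow> real ^ 'd ^ 'd \<Rightarrow> bool" where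
  "congruent_frameworks p L q L' \<longleftrightarrow>
    (\<exists>M x. orthogonal_matrix M \<and> (\<forall>v. q v = M *v p v + x) \<and> L' = M ** L)"

definition fixed_lattice_globally_rigid ::
  "('v::finite, 'd::finite) edge set \<Rightarrow> ('v \<Rightarrow> real ^ 'd) \<Rightarrow> real ^ 'd ^ 'd \<Rightarrow> bool" where
  "fixed_lattice_globally_rigid E p L \<longleftrightarrow>
    (\<forall>q. equivalent_frameworks E p L q L \<longrightarrow> congruent_frameworks p L q L)"

text \<open>
  Polynomials over the rationals in variables indexed by \<open>'i\<close> are the elements of
  \<open>('i \<Rightarrow>\<^sub>0 nat) \<Rightarrow>\<^sub>0 rat\<close>: finitely supported maps from exponent vectors to coefficients.
\<close>

definition eval_rat_mpoly :: "('i::finite \<Rightarrow> real) \<Rightarrow> (('i \<Rightarrow>\<^sub>0 nat) \<Rightarrow>\<^sub>0 rat) \<Rightarrow> real" where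
  "eval_rat_mpoly a P =
    (\<Sum>m\<in>Poly_Mapping.keys P.
      of_rat (Poly_Mapping.lookup P m) * (\<Prod>i\<in>UNIV. a i ^ Poly_Mapping.lookup m i))"

definition algebraically_independent_over_rat :: "('i::finite \<Rightarrow> real) \<Rightarrow> bool" where
  "algebraically_independent_over_rat a \<longleftrightarrow> (\<forall>P. eval_rat_mpoly a P = 0 \<longrightarrow> P = 0)"

definition framework_coords ::
  "('v::finite \<Rightarrow> real ^ 'd::finite) \<Rightarrow> real ^ 'd ^ 'd \<Rightarrow> ('v \<times> 'd) + ('d \<times> 'd) \<Rightarrow> real" where
  "framework_coords p L = case_sum (\<lambda>(v, i). p v $ i) (\<lambda>(i, j). L $ i $ j)"

definition generic_framework :: "('v::finite \<Rightarrow> real ^ 'd::finite) \<Rightarrow> real ^ 'd ^ 'd \<Rightarrow> bool" where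
  "generic_framework p L \<longleftrightarrow> algebraically_independent_over_rat (framework_coords p L)"

text \<open>
  For an edge \<open>e\<close> and a vertex \<open>x\<close> the inner sum has exactly one term if \<open>e\<close> is a non-loop edge
  at \<open>x\<close> (its unique description \<open>(u, x, \<gamma>)\<close>), and none otherwise. Values of \<open>\<omega>\<close> outside \<open>E\<close>
  are irrelevant.
\<close>

definition fixed_lattice_equilibrium_stress ::
  "('v::finite, 'd::finite) edge set \<Rightarrow> ('v \<Rightarrow> real ^ 'd) \<Rightarrow> real ^ 'd ^ 'd
    \<Rightarrow> (('v, 'd) edge \<Rightarrow> real) \<Rightarrow> bool" where
  "fixed_lattice_equilibrium_stress E p L \<omega> \<longleftrightarrow>
    (\<forall>x. (\<Sum>e\<in>E. \<Sum>(u, \<gamma>)\<in>{(u, \<gamma>). u \<noteq> x \<and> (u, x, \<gamma>) \<in> e}.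
            \<omega> e *\<^sub>R (p x + lattice_vec L \<gamma> - p u)) = 0)"

text \<open>
  \<open>rep\<close> selects the fixed representative of each edge. The edge set is not a type, so the
  \<open>|E| \<times> |V|\<close> matrix \<open>I(G)\<close> is a two-argument function and the product
  \<open>I(G)\<^sup>T diag(\<omega>) I(G)\<close> is written entrywise.
\<close>

definition incidence :: "(('v, 'd) edge \<Rightarrow> ('v, 'd) triple) \<Rightarrow> ('v, 'd) edge \<Rightarrow> 'v \<Rightarrow> real" where
  "incidence rep e x =
    (case rep e of (u, v, \<gamma>) \<Rightarrow>
      if u = v then 0 else if x = u then - 1 else if x = v then 1 else 0)"

definition laplacian ::
  "(('v::finite, 'd::finite) edge \<Rightarrow> ('v, 'd) triple) \<Rightarrow> ('v, 'd) edge set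
    \<Rightarrow> (('v, 'd) edge \<Rightarrow> real) \<Rightarrow> real ^ 'v ^ 'v" where
  "laplacian rep E \<omega> = (\<chi> x y. \<Sum>e\<in>E. incidence rep e x * \<omega> e * incidence rep e y)"

end

theory Submission
  imports Defs
begin

text \<open>
  As the coordinates of \<open>p\<close> and \<open>L\<close> are algebraically independent, every velocity \<open>p'\<close> is the value
  \<open>D p\<close> of a derivation \<open>D\<close> of the field of real numbers with \<open>D L = 0\<close>. Applying \<open>D\<close> to the
  equations at hand replaces the usual arguments with smooth or semialgebraic sets.

  Given a stress \<open>\<omega>\<close> with one-dimensional kernel, applying \<open>D\<close> to its equilibrium equation shows that
  \<open>(p, L)\<close> is infinitesimally rigid; applying \<open>D\<close> to the equality of lengths then shows that \<open>\<omega>\<close> is a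
  stress of every equivalent \<open>q\<close>. Hence \<open>q - p\<close> lies in the kernel of the Laplacian and is constant.

  Conversely, let \<open>(p, L)\<close> be globally rigid and let \<open>\<omega>\<close> be a stress whose Laplacian has minimal
  nullity. Differentiating the stress equation shows that the squared edge lengths of any \<open>z\<close> in the
  kernel \<open>N\<close> of the Laplacian are of the form \<open>R z'\<close> with \<open>z'\<close> in \<open>N\<close>, where \<open>R\<close> is the rigidity matrix
  of \<open>p\<close>. If \<open>N\<close> contained a nonconstant vector, Brouwer's fixed point theorem on the cone \<open>R z \<ge> 0\<close>
  in \<open>N\<close> would provide a nonconstant \<open>z\<close> in \<open>N\<close> such that \<open>p + z\<close> is equivalent to \<open>p\<close>.
\<close>

section \<open>Derivations of the real numbers\<close>

text \<open>
  The graph of a derivation on a subring of the reals, seen as a subring of the dual numbers: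
  the pair \<open>(x, x')\<close> stands for \<open>x + x' \<epsilon>\<close> with \<open>\<epsilon>\<^sup>2 = 0\<close>.
\<close>

definition dual_subring :: "(real \<times> real) set \<Rightarrow> bool" where
  "dual_subring G \<longleftrightarrow> (1, 0) \<in> G
    \<and> (\<forall>x x' y y'. (x, x') \<in> G \<longrightarrow> (y, y') \<in> G \<longrightarrow>
        (x - y, x' - y') \<in> G \<and> (x * y, x * y' + x' * y) \<in> G)
    \<and> (\<forall>y. (0, y) \<in> G \<longrightarrow> y = 0)"

lemma dual_subringD:
  assumes "dual_subring G"
  shows "(1, 0) \<in> G" "(0, 0) \<in> G"
    "(x, x') \<in> G \<Longrightarrow> (y, y') \<in> G \<Longrightarrow> (x - y, x' - y') \<in> G"
    "(x, x') \<in> G \<Longrightarrow> (y, y') \<in> G \<Longrightarrow> (x + y, x' + y') \<in> G"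
    "(x, x') \<in> G \<Longrightarrow> (y, y') \<in> G \<Longrightarrow> (x * y, x * y' + x' * y) \<in> G"
    "(0, y) \<in> G \<Longrightarrow> y = 0"
proof -
  have one: "(1, 0) \<in> G" and mi: "\<And>x x' y y'. (x, x') \<in> G \<Longrightarrow> (y, y') \<in> G \<Longrightarrow> (x - y, x' - y') \<in> G"
    using assms unfolding dual_subring_def by blast+
  then have zero: "(0, 0) \<in> G" using mi[OF one one] by simp
  show "(1, 0) \<in> G" "(0, 0) \<in> G" by fact+
  show "(x, x') \<in> G \<Longrightarrow> (y, y') \<in> G \<Longrightarrow> (x - y, x' - y') \<in> G" by (rule mi)
  show "(x, x') \<in> G \<Longrightarrow> (y, y') \<in> G \<Longrightarrow> (x + y, x' + y') \<in> G"
    using mi[of x x' "0 - y" "0 - y'"] mi[OF zero, of y y'] by simp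
  show "(x, x') \<in> G \<Longrightarrow> (y, y') \<in> G \<Longrightarrow> (x * y, x * y' + x' * y) \<in> G"
    using assms unfolding dual_subring_def by blast
  show "(0, y) \<in> G \<Longrightarrow> y = 0"
    using assms unfolding dual_subring_def by blast
qed

lemma dual_subring_sum:
  assumes "dual_subring G" "\<And>i. i \<in> A \<Longrightarrow> (f i, g i) \<in> G"
  shows "(sum f A, sum g A) \<in> G"
  using assms(2)
  by (induction A rule: infinite_finite_induct) (auto intro: dual_subringD[OF assms(1)])

lemma dual_subring_of_nat:
  assumes "dual_subring G" "(x, x') \<in> G"
  shows "(of_nat n * x, of_nat n * x') \<in> G"
  using dual_subring_sum[OF assms(1), of "{..<n}" "\<lambda>_. x" "\<lambda>_. x'"] assms(2) by simp

section \<open>Polynomials with dual number coefficients\<close>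

definition dual_poly :: "(real \<times> real) set \<Rightarrow> real poly \<Rightarrow> real poly \<Rightarrow> bool" where
  "dual_poly G f g \<longleftrightarrow> (\<forall>i. (coeff f i, coeff g i) \<in> G)"

text \<open>The pair of \<open>f\<close> and \<open>g\<close> stands for
  \<open>f + g \<epsilon>\<close>; this is the \<open>\<epsilon>\<close>-part of its value at the
  dual number \<open>x + \<delta> \<epsilon>\<close>, while \<open>poly f x\<close> is the real
  part.\<close>

definition dual_eval :: "real \<Rightarrow> real \<Rightarrow> real poly \<Rightarrow> real poly \<Rightarrow> real" where
  "dual_eval x \<delta> f g = poly g x + poly (pderiv f) x * \<delta>"

lemma dual_poly_diff:
  "dual_subring G \<Longrightarrow> dual_poly G f g \<Longrightarrow> dual_poly G f' g' \<Longrightarrow> dual_poly G (f - f') (g - g')"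
  by (simp add: dual_poly_def dual_subringD)

lemma dual_poly_mult:
  assumes "dual_subring G" "dual_poly G f g" "dual_poly G f' g'"
  shows "dual_poly G (f * f') (f * g' + g * f')"
  using assms unfolding dual_poly_def coeff_mult coeff_add sum.distrib[symmetric]
  by (auto intro!: dual_subring_sum dual_subringD(5))

lemma dual_poly_monom:
  assumes "dual_subring G" "(x, x') \<in> G"
  shows "dual_poly G (monom x n) (monom x' n)"
  using assms by (auto simp: dual_poly_def dual_subringD)

lemma dual_poly_pderiv:
  assumes "dual_subring G" "dual_poly G f g"
  shows "dual_poly G (pderiv f) (pderiv g)"
  using assms dual_subring_of_nat[OF assms(1)] unfolding dual_poly_def coeff_pderiv by blast

lemma dual_eval_diff: "dual_eval x \<delta> (f - f') (g - g') = dual_eval x \<delta> f g - dual_eval x \<delta> f' g'"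
  by (simp add: dual_eval_def pderiv_diff algebra_simps)

lemma dual_eval_mult: "dual_eval x \<delta> (f * f') (f * g' + g * f')
    = poly f x * dual_eval x \<delta> f' g' + dual_eval x \<delta> f g * poly f' x"
  by (simp add: dual_eval_def pderiv_mult algebra_simps)

text \<open>
  The derivative \<open>\<delta>\<close> of \<open>x\<close> is forced by a relation of minimal degree of \<open>x\<close> over the domain of \<open>G\<close>,
  and arbitrary if there is none.
\<close>

lemma dual_eval_well_defined:
  assumes G: "dual_subring G"
  shows "\<exists>\<delta>. \<forall>f g. dual_poly G f g \<longrightarrow> poly f x = 0 \<longrightarrow> dual_eval x \<delta> f g = 0"
proof -
  have zero: "dual_eval x \<delta> 0 g = 0" if "dual_poly G 0 g" for g \<delta>
  proof -
    have "coeff g i = 0" for i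
      using that dual_subringD(6)[OF G] by (simp add: dual_poly_def)
    then have "g = 0" by (simp add: poly_eq_iff)
    then show ?thesis by (simp add: dual_eval_def)
  qed
  define P where "P k \<longleftrightarrow> (\<exists>f g. dual_poly G f g \<and> poly f x = 0 \<and> f \<noteq> 0 \<and> degree f = k)" for k
  show ?thesis
  proof (cases "\<exists>k. P k")
    case False
    then have "f = 0" if "dual_poly G f g" "poly f x = 0" for f g
      using that unfolding P_def by blast
    then show ?thesis using zero by blast
  next
    case True
    define k where "k = (LEAST k. P k)"
    have "P k" unfolding k_def using True by (rule LeastI_ex)
    then obtain m n where m: "dual_poly G m n" "poly m x = 0" "m \<noteq> 0" "degree m = k"
      unfolding P_def by blast
    have small: "f = 0" if "dual_poly G f g" "poly f x = 0" "degree f < k" for f g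
      using that not_less_Least[of "degree f" P] unfolding P_def k_def by blast
    have k0: "k > 0"
    proof (rule ccontr)
      assume "\<not> k > 0"
      then obtain c where "m = [:c:]" using m(4) by (metis degree_eq_zeroE gr0I)
      then show False using m by simp
    qed
    \<comment> \<open>The derivative has smaller degree and also lifts to \<open>G\<close>, so by
      minimality it could vanish at \<open>x\<close> only if it were zero, which characteristic 0
      excludes.\<close>
    have m': "poly (pderiv m) x \<noteq> 0"
    proof
      assume "poly (pderiv m) x = 0"
      then have "pderiv m = 0"
        using small[OF dual_poly_pderiv[OF G m(1)]] degree_pderiv[of m] m(4) k0 by simp
      then show False using m(4) k0 by (simp add: pderiv_eq_0_iff)
    qed
    define \<delta> where "\<delta> = - poly n x / poly (pderiv m) x"
    have dm: "dual_eval x \<delta> m n = 0" using m' by (simp add: dual_eval_def \<delta>_def)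
    have "dual_eval x \<delta> f g = 0" if "dual_poly G f g" "poly f x = 0" for f g
      using that
    proof (induction "degree f" arbitrary: f g rule: less_induct)
      case less
      show ?case
      proof (cases "degree f < k")
        case True
        then have "f = 0" using small less.prems by blast
        then show ?thesis using zero less.prems by blast
      next
        case False
        define l where "l = degree f - k"
        define a a' where "a = coeff m k" and "a' = coeff n k"
        define b b' where "b = coeff f (degree f)" and "b' = coeff g (degree f)"
        have a0: "a \<noteq> 0" using m unfolding a_def by auto
        have aG: "(a, a') \<in> G" and bG: "(b, b') \<in> G"
          using m(1) less.prems(1) unfolding dual_poly_def a_def a'_def b_def b'_def by auto
        define A A' where "A = monom a 0" and "A' = monom a' 0"
        define B B' where "B = monom b l" and "B' = monom b' l"
        have AG: "dual_poly G A A'" and BG: "dual_poly G B B'"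
          unfolding A_def A'_def B_def B'_def using dual_poly_monom G aG bG by blast+
        \<comment> \<open>Pseudo-division: the domain of \<open>G\<close> is only a ring, so
          \<open>f\<close> is multiplied by the leading coefficient of \<open>m\<close> before the
          leading terms are cancelled. \<open>h'\<close> is the matching
          \<open>\<epsilon>\<close>-part.\<close>
        define h where "h = A * f - B * m"
        define h' where "h' = (A * g + A' * f) - (B * n + B' * m)"
        have hG: "dual_poly G h h'"
          unfolding h_def h'_def
          by (intro dual_poly_diff dual_poly_mult G AG BG less.prems m)
        have hx: "poly h x = 0" using less.prems m by (simp add: h_def)
        have "h = 0 \<or> degree h < degree f"
        proof -
          have "degree h \<le> degree f"
            unfolding h_def
          proof (rule degree_diff_le)
            show "degree (A * f) \<le> degree f" unfolding A_def monom_0 by simp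
            show "degree (B * m) \<le> degree f"
              using degree_mult_le[of B m] degree_monom_le[of b l] m(4) False
              unfolding B_def l_def by linarith
          qed
          moreover have "coeff h (degree f) = 0"
            using False by (simp add: h_def A_def B_def coeff_monom_mult monom_0 l_def a_def b_def)
          ultimately show ?thesis by (metis le_neq_implies_less leading_coeff_0_iff)
        qed
        then have "dual_eval x \<delta> h h' = 0"
          using less.hyps hG hx zero by blast
        then have "poly A x * dual_eval x \<delta> f g = 0"
          unfolding h_def h'_def dual_eval_diff dual_eval_mult using less.prems m dm by simp
        then show ?thesis using a0 by (simp add: A_def monom_0)
      qed
    qed
    then show ?thesis by blast
  qed
qed

text \<open>\<open>x\<close> is adjoined by evaluating all polynomials over \<open>G\<close> at
  \<open>x + \<delta> \<epsilon>\<close>. The choice of \<open>\<delta>\<close> just made is what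
  keeps the second component determined by the first.\<close>

lemma dual_subring_extend:
  assumes G: "dual_subring G"
  shows "\<exists>G'. dual_subring G' \<and> G \<subseteq> G' \<and> x \<in> Domain G'"
proof -
  obtain \<delta> where \<delta>: "\<And>f g. dual_poly G f g \<Longrightarrow> poly f x = 0 \<Longrightarrow> dual_eval x \<delta> f g = 0"
    using dual_eval_well_defined[OF G] by blast
  define G' where "G' = {(poly f x, dual_eval x \<delta> f g) | f g. dual_poly G f g}"
  have sub: "(c, c') \<in> G'" if "(c, c') \<in> G" for c c'
  proof -
    have "dual_poly G [:c:] [:c':]" using dual_poly_monom[OF G that, of 0] by (simp add: monom_0)
    moreover have "poly [:c:] x = c" "dual_eval x \<delta> [:c:] [:c':] = c'"
      by (simp_all add: dual_eval_def pderiv_pCons)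
    ultimately show ?thesis unfolding G'_def by (metis (mono_tags, lifting) mem_Collect_eq)
  qed
  have "dual_subring G'"
    unfolding dual_subring_def
  proof (intro conjI allI impI)
    show "(1, 0) \<in> G'" using sub dual_subringD(1)[OF G] by blast
    show "(a - b, a' - b') \<in> G'" if ab: "(a, a') \<in> G'" "(b, b') \<in> G'" for a a' b b'
      using ab dual_poly_diff[OF G] unfolding G'_def
      by (force simp: dual_eval_diff simp flip: poly_diff)
    show "(a * b, a * b' + a' * b) \<in> G'" if ab: "(a, a') \<in> G'" "(b, b') \<in> G'" for a a' b b'
      using ab dual_poly_mult[OF G] unfolding G'_def
      by (force simp: dual_eval_mult[symmetric] simp flip: poly_mult)
    show "y = 0" if "(0, y) \<in> G'" for y
      using that \<delta> unfolding G'_def by auto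
  qed
  moreover have "x \<in> Domain G'"
  proof -
    have "dual_poly G (monom 1 1) (monom 0 1)"
      using dual_poly_monom[OF G dual_subringD(1)[OF G]] .
    then have "(poly (monom 1 1) x, dual_eval x \<delta> (monom 1 1) (monom 0 1)) \<in> G'"
      unfolding G'_def by blast
    then show ?thesis by (auto simp: poly_monom)
  qed
  ultimately show ?thesis using sub by auto
qed

section \<open>Derivations of the whole field\<close>

definition derivation :: "(real \<Rightarrow> real) \<Rightarrow> bool" where
  "derivation D \<longleftrightarrow> (\<forall>x y. D (x + y) = D x + D y) \<and> (\<forall>x y. D (x * y) = x * D y + D x * y)"

text \<open>By Zorn's lemma there is a maximal dual subring above \<open>G\<close>. Its domain is
  everything by the extension lemma, and it is the graph of a function because two pairs with equal
  first component differ by a pair \<open>(0, y)\<close>.\<close>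

lemma dual_subring_derivation:
  assumes "dual_subring G"
  shows "\<exists>D. derivation D \<and> (\<forall>(x, x') \<in> G. D x = x')"
proof -
  define \<A> where "\<A> = {H. dual_subring H \<and> G \<subseteq> H}"
  have "\<exists>M\<in>\<A>. \<forall>H\<in>\<A>. M \<subseteq> H \<longrightarrow> H = M"
  proof (rule subset_Zorn_nonempty)
    show "\<A> \<noteq> {}" using assms by (auto simp: \<A>_def)
    fix C assume C: "C \<noteq> {}" "subset.chain \<A> C"
    have two: "\<exists>H\<in>C. s \<in> H \<and> t \<in> H" if st: "s \<in> \<Union>C" "t \<in> \<Union>C" for s t
    proof -
      obtain H K where "H \<in> C" "K \<in> C" "s \<in> H" "t \<in> K" using st by blast
      moreover from this have "H \<subseteq> K \<or> K \<subseteq> H" using C(2) unfolding subset.chain_def by blast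
      ultimately show ?thesis by blast
    qed
    have mem: "dual_subring H" if "H \<in> C" for H
      using that C(2) unfolding subset.chain_def \<A>_def by blast
    have "dual_subring (\<Union>C)"
      unfolding dual_subring_def[of "\<Union>C"]
    proof (intro conjI allI impI)
      show "(1, 0) \<in> \<Union>C" using C(1) dual_subringD(1)[OF mem] by blast
      show "(x - y, x' - y') \<in> \<Union>C" if "(x, x') \<in> \<Union>C" "(y, y') \<in> \<Union>C" for x x' y y'
        using two[OF that] by (auto intro: dual_subringD(3)[OF mem])
      show "(x * y, x * y' + x' * y) \<in> \<Union>C" if "(x, x') \<in> \<Union>C" "(y, y') \<in> \<Union>C" for x x' y y'
        using two[OF that] by (auto intro: dual_subringD(5)[OF mem])
      show "y = 0" if "(0, y) \<in> \<Union>C" for y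
        using that by (auto dest: dual_subringD(6)[OF mem])
    qed
    moreover have "G \<subseteq> \<Union>C"
      using C unfolding \<A>_def subset.chain_def by fast
    ultimately show "\<Union>C \<in> \<A>" unfolding \<A>_def by simp
  qed
  then obtain M where M: "dual_subring M" "G \<subseteq> M"
      and max: "\<And>H. dual_subring H \<Longrightarrow> M \<subseteq> H \<Longrightarrow> H = M"
    unfolding \<A>_def by (auto dest: subset_trans)
  have uniq: "x' = x''" if "(x, x') \<in> M" "(x, x'') \<in> M" for x x' x''
    using dual_subringD(6)[OF M(1), of "x' - x''"] dual_subringD(3)[OF M(1) that] by simp
  have "\<exists>x'. (x, x') \<in> M" for x
  proof -
    obtain H where "dual_subring H" "M \<subseteq> H" "x \<in> Domain H"
      using dual_subring_extend[OF M(1)] by metis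
    with max show ?thesis by (metis Domain_iff)
  qed
  then obtain D where D: "\<And>x. (x, D x) \<in> M" by metis
  have "derivation D"
    unfolding derivation_def
  proof (intro conjI allI)
    fix x y
    show "D (x + y) = D x + D y" by (rule uniq[OF D dual_subringD(4)[OF M(1) D D]])
    show "D (x * y) = x * D y + D x * y" by (rule uniq[OF D dual_subringD(5)[OF M(1) D D]])
  qed
  moreover have "\<forall>(x, x') \<in> G. D x = x'" using uniq[OF D] M(2) by blast
  ultimately show ?thesis by blast
qed

section \<open>Polynomials at algebraically independent points\<close>

lemma eval_rat_mpoly_superset:
  assumes "finite S" "Poly_Mapping.keys P \<subseteq> S"
  shows "eval_rat_mpoly a P =
    (\<Sum>m\<in>S. of_rat (Poly_Mapping.lookup P m) * (\<Prod>i\<in>UNIV. a i ^ Poly_Mapping.lookup m i))"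
  unfolding eval_rat_mpoly_def using assms
  by (intro sum.mono_neutral_left) (auto simp: in_keys_iff)

lemma eval_rat_mpoly_single:
  "eval_rat_mpoly a (Poly_Mapping.single m c) = of_rat c * (\<Prod>i\<in>UNIV. a i ^ Poly_Mapping.lookup m i)"
  by (subst eval_rat_mpoly_superset[of "{m}"]) auto

lemma eval_rat_mpoly_add: "eval_rat_mpoly a (P + Q) = eval_rat_mpoly a P + eval_rat_mpoly a Q"
proof -
  let ?S = "Poly_Mapping.keys P \<union> Poly_Mapping.keys Q"
  have "Poly_Mapping.keys (P + Q) \<subseteq> ?S" by (rule Poly_Mapping.keys_add)
  then show ?thesis
    by (simp add: eval_rat_mpoly_superset[of ?S] lookup_add of_rat_add algebra_simps sum.distrib)
qed

lemma eval_rat_mpoly_0 [simp]: "eval_rat_mpoly a 0 = 0"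
  by (simp add: eval_rat_mpoly_def)

lemma eval_rat_mpoly_sum: "eval_rat_mpoly a (\<Sum>k\<in>A. P k) = (\<Sum>k\<in>A. eval_rat_mpoly a (P k))"
  by (induction A rule: infinite_finite_induct) (auto simp: eval_rat_mpoly_add)

lemma poly_mapping_sum_single:
  "(\<Sum>m\<in>Poly_Mapping.keys P. Poly_Mapping.single m (Poly_Mapping.lookup P m)) = P"
proof (rule poly_mapping_eqI)
  fix k
  show "Poly_Mapping.lookup (\<Sum>m\<in>Poly_Mapping.keys P. Poly_Mapping.single m (Poly_Mapping.lookup P m)) k
    = Poly_Mapping.lookup P k"
    by (simp add: lookup_sum lookup_single when_def in_keys_iff)
qed

lemma eval_rat_mpoly_mult: "eval_rat_mpoly a (P * Q) = eval_rat_mpoly a P * eval_rat_mpoly a Q"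
proof -
  let ?s = "\<lambda>P m. Poly_Mapping.single m (Poly_Mapping.lookup P m)"
  have s: "eval_rat_mpoly a (?s P m * ?s Q n) = eval_rat_mpoly a (?s P m) * eval_rat_mpoly a (?s Q n)"
    for m n
    by (simp add: mult_single eval_rat_mpoly_single of_rat_mult lookup_add power_add prod.distrib)
  have "P * Q = (\<Sum>m\<in>Poly_Mapping.keys P. ?s P m) * (\<Sum>n\<in>Poly_Mapping.keys Q. ?s Q n)"
    by (simp only: poly_mapping_sum_single)
  also have "\<dots> = (\<Sum>m\<in>Poly_Mapping.keys P. \<Sum>n\<in>Poly_Mapping.keys Q. ?s P m * ?s Q n)"
    by (rule sum_product)
  finally have "eval_rat_mpoly a (P * Q) =
      (\<Sum>m\<in>Poly_Mapping.keys P. eval_rat_mpoly a (?s P m)) * (\<Sum>n\<in>Poly_Mapping.keys Q. eval_rat_mpoly a (?s Q n))"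
    by (simp add: eval_rat_mpoly_sum s sum_product)
  then show ?thesis
    by (simp only: eval_rat_mpoly_sum[symmetric] poly_mapping_sum_single)
qed

text \<open>Later arguments work with the induced functions and their closure properties instead of
  formal polynomials.\<close>

definition rat_poly_fun :: "(('i::finite \<Rightarrow> real) \<Rightarrow> real) \<Rightarrow> bool" where
  "rat_poly_fun g \<longleftrightarrow> (\<exists>P. \<forall>a. g a = eval_rat_mpoly a P)"

lemma rat_poly_fun_const: "rat_poly_fun (\<lambda>a. of_rat c)"
  unfolding rat_poly_fun_def
  by (intro exI[of _ "Poly_Mapping.single 0 c"]) (simp add: eval_rat_mpoly_single)

lemma rat_poly_fun_0 [simp]: "rat_poly_fun (\<lambda>a. 0)"
  and rat_poly_fun_1 [simp]: "rat_poly_fun (\<lambda>a. 1)"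
  and rat_poly_fun_of_int [simp]: "rat_poly_fun (\<lambda>a. of_int k)"
  using rat_poly_fun_const[of 0] rat_poly_fun_const[of 1] rat_poly_fun_const[of "of_int k"] by simp_all

lemma rat_poly_fun_coord [simp]: "rat_poly_fun (\<lambda>a. a i)"
proof -
  have "(\<Prod>j\<in>UNIV. a j ^ Poly_Mapping.lookup (Poly_Mapping.single i 1) j) = a i"
    for a :: "'a \<Rightarrow> real"
    by (subst prod.remove[of _ i]) (auto simp: lookup_single when_def intro!: prod.neutral)
  then show ?thesis
    unfolding rat_poly_fun_def
    by (intro exI[of _ "Poly_Mapping.single (Poly_Mapping.single i 1) 1"]) (simp add: eval_rat_mpoly_single)
qed

lemma rat_poly_fun_add:
  "rat_poly_fun f \<Longrightarrow> rat_poly_fun g \<Longrightarrow> rat_poly_fun (\<lambda>a. f a + g a)"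
  unfolding rat_poly_fun_def by (metis eval_rat_mpoly_add)

lemma rat_poly_fun_mult:
  "rat_poly_fun f \<Longrightarrow> rat_poly_fun g \<Longrightarrow> rat_poly_fun (\<lambda>a. f a * g a)"
  unfolding rat_poly_fun_def by (metis eval_rat_mpoly_mult)

lemma rat_poly_fun_diff:
  "rat_poly_fun f \<Longrightarrow> rat_poly_fun g \<Longrightarrow> rat_poly_fun (\<lambda>a. f a - g a)"
  using rat_poly_fun_add[of f "\<lambda>a. of_int (- 1) * g a"]
    rat_poly_fun_mult[OF rat_poly_fun_of_int[of "- 1"], of g]
  by simp

lemma rat_poly_fun_sum:
  "(\<And>k. k \<in> A \<Longrightarrow> rat_poly_fun (f k)) \<Longrightarrow> rat_poly_fun (\<lambda>a. \<Sum>k\<in>A. f k a)"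
  by (induction A rule: infinite_finite_induct) (auto intro: rat_poly_fun_add)

lemma rat_poly_fun_prod:
  "(\<And>k. k \<in> A \<Longrightarrow> rat_poly_fun (f k)) \<Longrightarrow> rat_poly_fun (\<lambda>a. \<Prod>k\<in>A. f k a)"
  by (induction A rule: infinite_finite_induct) (auto intro: rat_poly_fun_mult)

text \<open>Only the zero polynomial vanishes at \<open>a\<close>, so every polynomial identity over
  the rationals spreads from a generic point to all points.\<close>

lemma rat_poly_fun_eq_0:
  assumes "algebraically_independent_over_rat a" "rat_poly_fun f" "f a = 0"
  shows "f b = 0"
proof -
  obtain P where P: "\<And>a. f a = eval_rat_mpoly a P" using assms(2) unfolding rat_poly_fun_def by blast
  then have "P = 0" using assms(1,3) unfolding algebraically_independent_over_rat_def by metis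
  then show ?thesis using P by simp
qed

section \<open>Derivations prescribed at an algebraically independent point\<close>

lemma differentiable_prod_real:
  fixes f :: "'k \<Rightarrow> real \<Rightarrow> real"
  shows "(\<And>k. k \<in> A \<Longrightarrow> f k differentiable at x within S)
    \<Longrightarrow> (\<lambda>t. \<Prod>k\<in>A. f k t) differentiable at x within S"
  by (induction A rule: infinite_finite_induct) (auto intro!: differentiable_mult)

lemma eval_rat_mpoly_line_differentiable:
  "(\<lambda>t. eval_rat_mpoly (\<lambda>i. a i + t * d i) P) differentiable at t"
  unfolding eval_rat_mpoly_def
  by (cases "finite (Poly_Mapping.keys P)")
    (auto intro!: differentiable_sum differentiable_mult differentiable_prod_real)

text \<open>
  The values of the polynomials at \<open>a\<close> carry the directional derivative along \<open>d\<close>, which is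
  well defined because a polynomial is determined by its value at \<open>a\<close>.
\<close>

lemma algebraically_independent_derivation:
  fixes a d :: "'i::finite \<Rightarrow> real"
  assumes a: "algebraically_independent_over_rat a"
  shows "\<exists>D. derivation D \<and> (\<forall>i. D (a i) = d i)"
proof -
  let ?e = "\<lambda>f t. f (\<lambda>i. a i + t * d i) :: real"
  define G where "G = {(f a, deriv (?e f) 0) | f. rat_poly_fun f}"
  have diff: "DERIV (?e f) 0 :> deriv (?e f) 0" if "rat_poly_fun f" for f
  proof -
    obtain P where "f = (\<lambda>a. eval_rat_mpoly a P)" using \<open>rat_poly_fun f\<close> unfolding rat_poly_fun_def by blast
    then show ?thesis
      using eval_rat_mpoly_line_differentiable[of a d P 0]
      by (simp add: DERIV_deriv_iff_real_differentiable)
  qed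
  have G: "(f a, f') \<in> G" if "rat_poly_fun f" "DERIV (?e f) 0 :> f'" for f f'
    using that DERIV_imp_deriv[OF that(2)] unfolding G_def by blast
  have "dual_subring G"
    unfolding dual_subring_def
  proof (intro conjI allI impI)
    show "(1, 0) \<in> G" using G[of "\<lambda>_. 1" 0] by simp
  next
    fix x x' y y' assume "(x, x') \<in> G" "(y, y') \<in> G"
    then obtain f g where f: "rat_poly_fun f" "x = f a" "x' = deriv (?e f) 0"
      and g: "rat_poly_fun g" "y = g a" "y' = deriv (?e g) 0"
      unfolding G_def by blast
    show "(x - y, x' - y') \<in> G"
      using G[OF rat_poly_fun_diff[OF f(1) g(1)] DERIV_diff[OF diff[OF f(1)] diff[OF g(1)]]] f g by simp
    show "(x * y, x * y' + x' * y) \<in> G"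
      using G[OF rat_poly_fun_mult[OF f(1) g(1)] DERIV_mult[OF diff[OF f(1)] diff[OF g(1)]]] f g
      by (simp add: algebra_simps)
  next
    fix y assume "(0, y) \<in> G"
    then obtain f where f: "rat_poly_fun f" "f a = 0" "y = deriv (?e f) 0"
      unfolding G_def by auto
    then have "?e f = (\<lambda>_. 0)" using rat_poly_fun_eq_0[OF a] by blast
    then show "y = 0" using f(3) by simp
  qed
  then obtain D where D: "derivation D" "\<forall>(x, x') \<in> G. D x = x'"
    using dual_subring_derivation by blast
  have "(a i, d i) \<in> G" for i
    by (rule G[of "\<lambda>a. a i", simplified]) (auto intro!: derivative_eq_intros)
  then have "D (a i) = d i" for i using bspec[OF D(2), of "(a i, d i)"] by simp
  then show ?thesis using D(1) by blast
qed

text \<open>Gaussian elimination without division keeps all entries in the ring \<open>K\<close>.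
  The real solution \<open>z\<close> survives every elimination and certifies that the coordinate
  \<open>j0\<close>, which is never eliminated, can be nonzero.\<close>

lemma homogeneous_system_subring:
  fixes A :: "'e \<Rightarrow> 'j \<Rightarrow> real"
  assumes K: "1 \<in> K" "\<And>x y. x \<in> K \<Longrightarrow> y \<in> K \<Longrightarrow> x - y \<in> K" "\<And>x y. x \<in> K \<Longrightarrow> y \<in> K \<Longrightarrow> x * y \<in> K"
    and J: "finite J" "j0 \<notin> J"
    and A: "\<And>e j. e \<in> E \<Longrightarrow> j \<in> insert j0 J \<Longrightarrow> A e j \<in> K"
    and z: "\<And>e. e \<in> E \<Longrightarrow> (\<Sum>j\<in>insert j0 J. A e j * z j) = 0" "z j0 \<noteq> 0"
  shows "\<exists>y. (\<forall>j\<in>insert j0 J. y j \<in> K) \<and> (\<forall>e\<in>E. (\<Sum>j\<in>insert j0 J. A e j * y j) = 0) \<and> y j0 \<noteq> 0"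
  using J A z
proof (induction J arbitrary: A rule: finite_induct)
  case empty
  \<comment> \<open>Only \<open>j0\<close> is left, and \<open>z j0 \<noteq> 0\<close> forces its
    coefficient to vanish in every equation.\<close>
  then show ?case using K(1) by (intro exI[of _ "\<lambda>_. 1"]) auto
next
  case (insert j J)
  have K0: "0 \<in> K" using K(2)[OF K(1) K(1)] by simp
  have Kp: "x + y \<in> K" if "x \<in> K" "y \<in> K" for x y
    using K(2)[OF that(1) K(2)[OF K0 that(2)]] by simp
  have Ks: "(\<Sum>i\<in>S. f i) \<in> K" if "\<And>i. i \<in> S \<Longrightarrow> f i \<in> K" for f and S :: "'j set"
    using that by (induction S rule: infinite_finite_induct) (auto intro: Kp K0)
  let ?I = "insert j0 J"
  have j: "j \<notin> ?I" "finite ?I" using insert by auto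
  have split: "(\<Sum>i\<in>insert j0 (insert j J). f i) = f j + (\<Sum>i\<in>?I. f i)" for f :: "'j \<Rightarrow> real"
    unfolding insert_commute[of j0 j] using j by (intro sum.insert)
  have j0: "j0 \<notin> J" using insert by simp
  show ?case
  proof (cases "\<exists>f\<in>E. A f j \<noteq> 0")
    case False
    then have eqs: "(\<Sum>i\<in>?I. A e i * x i) = (\<Sum>i\<in>insert j0 (insert j J). A e i * x i)"
      if "e \<in> E" for e x using that by (simp only: split) simp
    have "\<exists>y. (\<forall>i\<in>?I. y i \<in> K) \<and> (\<forall>e\<in>E. (\<Sum>i\<in>?I. A e i * y i) = 0) \<and> y j0 \<noteq> 0"
      by (rule insert.IH[OF j0]) (use insert.prems eqs in auto)
    then obtain y where y: "\<forall>i\<in>?I. y i \<in> K" "\<forall>e\<in>E. (\<Sum>i\<in>?I. A e i * y i) = 0" "y j0 \<noteq> 0"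
      by blast
    have *: "(\<Sum>i\<in>?I. A e i * (y(j := 0)) i) = (\<Sum>i\<in>?I. A e i * y i)" for e
      using j by (intro sum.cong) auto
    have "(\<Sum>i\<in>insert j0 (insert j J). A e i * (y(j := 0)) i) = 0" if "e \<in> E" for e
      using y(2) that eqs[OF that, of "y(j := 0)"] * by simp
    moreover have "\<forall>i\<in>insert j0 (insert j J). (y(j := 0)) i \<in> K" using y(1) K0 by simp
    moreover have "(y(j := 0)) j0 \<noteq> 0" using y(3) j by auto
    ultimately show ?thesis by blast
  next
    case True
    then obtain f where f: "f \<in> E" "A f j \<noteq> 0" by blast
    \<comment> \<open>Equation \<open>f\<close> is the pivot: this combination of equations has
      coefficient 0 at \<open>j\<close>.\<close>
    define B where "B e i = A f j * A e i - A e j * A f i" for e i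
    have B: "(\<Sum>i\<in>?I. B e i * x i) = A f j * (\<Sum>i\<in>?I. A e i * x i) - A e j * (\<Sum>i\<in>?I. A f i * x i)" for e x
      by (simp only: B_def left_diff_distrib sum_subtractf sum_distrib_left mult.assoc)
    have "\<exists>y. (\<forall>i\<in>?I. y i \<in> K) \<and> (\<forall>e\<in>E. (\<Sum>i\<in>?I. B e i * y i) = 0) \<and> y j0 \<noteq> 0"
    proof (rule insert.IH[OF j0])
      show "B e i \<in> K" if "e \<in> E" "i \<in> ?I" for e i
        unfolding B_def using that f insert.prems(2) by (intro K(2) K(3)) auto
      show "(\<Sum>i\<in>?I. B e i * z i) = 0" if "e \<in> E" for e
      proof -
        have "(\<Sum>i\<in>?I. A e' i * z i) = - A e' j * z j" if "e' \<in> E" for e'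
          using insert.prems(3)[OF that] unfolding split by simp
        then show ?thesis unfolding B using \<open>e \<in> E\<close> f by simp
      qed
      show "z j0 \<noteq> 0" by fact
    qed
    then obtain y where y: "\<forall>i\<in>?I. y i \<in> K" "\<forall>e\<in>E. (\<Sum>i\<in>?I. B e i * y i) = 0" "y j0 \<noteq> 0"
      by blast
    define s where "s = (\<Sum>i\<in>?I. A f i * y i)"
    \<comment> \<open>Back substitution: scaling the other variables by the pivot
      \<open>A f j\<close> avoids dividing \<open>s\<close> by it. The form \<open>0 - s\<close>
      fits the closure of \<open>K\<close> under differences.\<close>
    define x where "x i = (if i = j then 0 - s else A f j * y i)" for i
    have xs: "(\<Sum>i\<in>?I. A e i * x i) = A f j * (\<Sum>i\<in>?I. A e i * y i)" for e
      unfolding sum_distrib_left using j by (intro sum.cong) (auto simp: x_def)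
    have "s \<in> K" unfolding s_def using f y(1) insert.prems(2) by (intro Ks K(3)) auto
    then have "0 - s \<in> K" by (rule K(2)[OF K0])
    then have "x i \<in> K" if "i \<in> insert j0 (insert j J)" for i
      unfolding x_def using that f y(1) insert.prems(2) by (auto intro!: K(3) simp del: diff_0)
    moreover have "(\<Sum>i\<in>insert j0 (insert j J). A e i * x i) = 0" if "e \<in> E" for e
      using y(2) that unfolding split xs B by (simp add: x_def s_def)
    moreover have "x j0 \<noteq> 0" using y f j unfolding x_def by auto
    ultimately show ?thesis by blast
  qed
qed

section \<open>Linear algebra and a quadratic system\<close>

text \<open>The Fredholm alternative on \<open>N\<close>. Each \<open>R e\<close> is replaced by its
  orthogonal projection \<open>r e\<close> to \<open>N\<close>; then the equations are added one at
  a time, a new one being either dependent on the earlier ones or independently adjustable.\<close>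

lemma solve_linear_system_subspace:
  fixes R :: "'e \<Rightarrow> 'a::euclidean_space" and Q :: "'e \<Rightarrow> real"
  assumes N: "subspace N" and E: "finite E"
    and compat: "\<And>\<eta>. (\<And>z. z \<in> N \<Longrightarrow> (\<Sum>e\<in>E. \<eta> e * (R e \<bullet> z)) = 0) \<Longrightarrow> (\<Sum>e\<in>E. \<eta> e * Q e) = 0"
  shows "\<exists>z\<in>N. \<forall>e\<in>E. R e \<bullet> z = Q e"
proof -
  have "\<exists>r\<in>N. \<forall>w\<in>N. R e \<bullet> w = r \<bullet> w" for e
  proof -
    obtain r s where "r \<in> span N" "\<And>w. w \<in> span N \<Longrightarrow> orthogonal s w" "R e = r + s"
      using orthogonal_subspace_decomp_exists[of N "R e"] by blast
    moreover have "span N = N" using N by simp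
    ultimately show ?thesis
      by (intro bexI[of _ r]) (auto simp: orthogonal_def inner_add_left)
  qed
  then obtain r where r: "\<And>e. r e \<in> N" "\<And>e w. w \<in> N \<Longrightarrow> R e \<bullet> w = r e \<bullet> w" by metis
  have "\<exists>z\<in>N. \<forall>e\<in>E. r e \<bullet> z = Q e"
    if "\<And>\<eta>. (\<Sum>e\<in>E. \<eta> e *\<^sub>R r e) = 0 \<Longrightarrow> (\<Sum>e\<in>E. \<eta> e * Q e) = 0"
    using E that
  proof (induction E rule: finite_induct)
    case empty
    then show ?case using subspace_0[OF N] by blast
  next
    case (insert f E)
    have upd: "(\<Sum>e\<in>insert f E. (\<eta>(f := c)) e *\<^sub>R r e) = c *\<^sub>R r f + (\<Sum>e\<in>E. \<eta> e *\<^sub>R r e)"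
      "(\<Sum>e\<in>insert f E. (\<eta>(f := c)) e * Q e) = c * Q f + (\<Sum>e\<in>E. \<eta> e * Q e)" for \<eta> c
    proof -
      have "(\<Sum>e\<in>E. (\<eta>(f := c)) e *\<^sub>R r e) = (\<Sum>e\<in>E. \<eta> e *\<^sub>R r e)"
        "(\<Sum>e\<in>E. (\<eta>(f := c)) e * Q e) = (\<Sum>e\<in>E. \<eta> e * Q e)"
        using insert.hyps by (auto intro!: sum.cong)
      then show "(\<Sum>e\<in>insert f E. (\<eta>(f := c)) e *\<^sub>R r e) = c *\<^sub>R r f + (\<Sum>e\<in>E. \<eta> e *\<^sub>R r e)"
        "(\<Sum>e\<in>insert f E. (\<eta>(f := c)) e * Q e) = c * Q f + (\<Sum>e\<in>E. \<eta> e * Q e)"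
        using insert.hyps by simp_all
    qed
    have "\<exists>z\<in>N. \<forall>e\<in>E. r e \<bullet> z = Q e"
    proof (rule insert.IH)
      fix \<eta> assume "(\<Sum>e\<in>E. \<eta> e *\<^sub>R r e) = 0"
      then show "(\<Sum>e\<in>E. \<eta> e * Q e) = 0" using insert.prems[of "\<eta>(f := 0)"] unfolding upd by simp
    qed
    then obtain z where z: "z \<in> N" "\<And>e. e \<in> E \<Longrightarrow> r e \<bullet> z = Q e" by blast
    \<comment> \<open>The span of the earlier rows, written as a range so that coefficients can be
      read off.\<close>
    define V where "V = range (\<lambda>c. \<Sum>e\<in>E. c e *\<^sub>R r e)"
    have sV: "subspace V"
      unfolding subspace_def
    proof (intro conjI ballI allI)
      show "0 \<in> V" unfolding V_def by (intro range_eqI[of _ _ "\<lambda>_. 0"]) simp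
      show "x + y \<in> V" if xy: "x \<in> V" "y \<in> V" for x y
      proof -
        obtain c d where "x = (\<Sum>e\<in>E. c e *\<^sub>R r e)" "y = (\<Sum>e\<in>E. d e *\<^sub>R r e)"
          using xy unfolding V_def by blast
        then show ?thesis unfolding V_def
          by (intro range_eqI[of _ _ "\<lambda>e. c e + d e"]) (simp add: scaleR_add_left sum.distrib)
      qed
      show "c *\<^sub>R x \<in> V" if x: "x \<in> V" for c x
      proof -
        obtain d where "x = (\<Sum>e\<in>E. d e *\<^sub>R r e)" using x unfolding V_def by blast
        then show ?thesis unfolding V_def
          by (intro range_eqI[of _ _ "\<lambda>e. c * d e"]) (simp add: scaleR_sum_right)
      qed
    qed
    have rV: "r e \<in> V" if "e \<in> E" for e
      unfolding V_def using that insert.hyps(1)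
      by (intro range_eqI[of _ _ "\<lambda>k. if k = e then 1 else 0"]) (simp add: if_distrib[of "\<lambda>c. c *\<^sub>R _"] cong: if_cong)
    have VN: "V \<subseteq> N" unfolding V_def using r(1) by (auto intro!: subspace_sum[OF N] subspace_scale[OF N])
    \<comment> \<open>\<open>y\<close> is the part of \<open>r f\<close> orthogonal to the earlier
      rows; moving along it leaves the earlier equations intact.\<close>
    obtain s y where sy: "s \<in> V" "\<And>w. w \<in> V \<Longrightarrow> orthogonal y w" "r f = s + y"
      using orthogonal_subspace_decomp_exists[of V "r f"] span_eq_iff[of V] sV by metis
    have yN: "y \<in> N" using subspace_diff[OF N r(1)[of f], of s] sy VN by auto
    show ?case
    proof (cases "y = 0")
      case True
      then obtain c where c: "r f = (\<Sum>e\<in>E. c e *\<^sub>R r e)" using sy unfolding V_def by auto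
      have "Q f = (\<Sum>e\<in>E. c e * Q e)"
        using insert.prems[of "c(f := - 1)"] unfolding upd using c by simp
      also have "\<dots> = (\<Sum>e\<in>E. c e * (r e \<bullet> z))" using z by simp
      also have "\<dots> = r f \<bullet> z" unfolding c by (simp add: inner_sum_left)
      finally show ?thesis using z by auto
    next
      case False
      have yr: "r e \<bullet> y = 0" if "e \<in> E" for e
        using sy(2)[OF rV[OF that]] by (simp add: orthogonal_def inner_commute)
      have "s \<bullet> y = 0" using sy(2)[OF sy(1)] by (simp add: orthogonal_def inner_commute)
      then have yf: "r f \<bullet> y = y \<bullet> y" using sy(3) by (simp add: inner_add_left)
      define t where "t = (Q f - r f \<bullet> z) / (y \<bullet> y)"
      have "r f \<bullet> (z + t *\<^sub>R y) = Q f" using False yf by (simp add: t_def inner_add_right)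
      moreover have "\<forall>e\<in>E. r e \<bullet> (z + t *\<^sub>R y) = Q e" using z yr by (simp add: inner_add_right)
      moreover have "z + t *\<^sub>R y \<in> N" using N z(1) yN by (simp add: subspace_add subspace_scale)
      ultimately show ?thesis by blast
    qed
  qed
  moreover have "(\<Sum>e\<in>E. \<eta> e * Q e) = 0" if "(\<Sum>e\<in>E. \<eta> e *\<^sub>R r e) = 0" for \<eta>
  proof (rule compat)
    fix z assume "z \<in> N"
    then have "(\<Sum>e\<in>E. \<eta> e * (R e \<bullet> z)) = (\<Sum>e\<in>E. \<eta> e *\<^sub>R r e) \<bullet> z"
      using r(2) by (simp add: inner_sum_left)
    then show "(\<Sum>e\<in>E. \<eta> e * (R e \<bullet> z)) = 0" using that by simp
  qed
  ultimately show ?thesis using r(2) by metis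
qed

text \<open>The component of \<open>w\<close> orthogonal to the range of \<open>F\<close> lies in
  the kernel of \<open>F\<close> by self-adjointness; orthogonality of \<open>w\<close> to the
  kernel then makes it 0.\<close>

lemma self_adjoint_image:
  fixes F :: "'a::euclidean_space \<Rightarrow> 'a"
  assumes F: "linear F" and adj: "\<And>x y. F x \<bullet> y = x \<bullet> F y"
    and w: "\<And>z. F z = 0 \<Longrightarrow> w \<bullet> z = 0"
  shows "\<exists>x. F x = w"
proof -
  have "subspace (range F)" using linear_subspace_image[OF F subspace_UNIV] by simp
  then obtain y z where yz: "y \<in> range F" "\<And>u. u \<in> range F \<Longrightarrow> orthogonal z u" "w = y + z"
    using orthogonal_subspace_decomp_exists[of "range F" w] span_eq_iff[of "range F"] by metis
  have "F z \<bullet> x = 0" for x using yz(2)[of "F x"] adj[of z x] by (simp add: orthogonal_def)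
  then have "F z = 0" using inner_eq_zero_iff by blast
  then have "w \<bullet> z = 0" by (rule w)
  moreover have "z \<bullet> y = 0" using yz(2)[OF yz(1)] by (simp add: orthogonal_def)
  ultimately have "z = 0" using yz(3) by (simp add: inner_add_left inner_commute[of y z])
  then show ?thesis using yz by auto
qed

text \<open>For a small \<open>t > 0\<close> the perturbed map is injective on the orthogonal
  complement of the kernel of \<open>F\<close> enlarged by \<open>z\<close>, so its rank exceeds
  that of \<open>F\<close>.\<close>

lemma kernel_dim_perturb:
  fixes F H :: "'a::euclidean_space \<Rightarrow> 'a"
  assumes F: "linear F" and H: "linear H" and adj: "\<And>x y. F x \<bullet> y = x \<bullet> F y"
    and z: "F z = 0" "z \<bullet> H z \<noteq> 0"
  shows "\<exists>t. dim {x. F x + t *\<^sub>R H x = 0} < dim {x. F x = 0}"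
proof -
  define U where "U = {x. F x = 0}"
  define Y where "Y = {y \<in> UNIV. \<forall>x\<in>U. orthogonal x y}"
  have U: "subspace U" unfolding U_def using F by (rule linear_subspace_kernel)
  have Y: "subspace Y" unfolding Y_def using subspace_orthogonal_to_vectors[of U] by simp
  have dims: "dim Y + dim U = DIM('a)"
    unfolding Y_def using dim_subspace_orthogonal_to_vectors[OF U subspace_UNIV] by simp
  have YU: "y = 0" if "y \<in> Y" "F y = 0" for y
    using that unfolding Y_def U_def by (auto simp: orthogonal_def)
  \<comment> \<open>\<open>F\<close> is injective on \<open>Y\<close>, hence bounded below
    there.\<close>
  obtain \<delta> where \<delta>: "\<delta> > 0" "\<And>y. y \<in> Y \<Longrightarrow> \<delta> * norm y \<le> norm (F y)"
    using injective_imp_isometric[OF closed_subspace[OF Y] Y linear_conv_bounded_linear[THEN iffD1, OF F]] YU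
    by (metis mult.commute)
  \<comment> \<open>The value of \<open>H\<close> at \<open>c\<close> times \<open>z\<close> plus
    \<open>y\<close>, after pairing the kernel equation with \<open>z\<close> has determined
    \<open>c\<close>.\<close>
  define K where "K y = H y - ((z \<bullet> H y) / (z \<bullet> H z)) *\<^sub>R H z" for y
  have "linear K" unfolding K_def
    by (rule linearI) (simp_all add: linear_add[OF H] linear_scale[OF H] inner_add_right algebra_simps add_divide_distrib)
  then obtain B where B: "B > 0" "\<And>y. norm (K y) \<le> B * norm y"
    using linear_bounded_pos by blast
  \<comment> \<open>As \<open>t * B = \<delta> / 2\<close>, the perturbation is too weak to cancel
    \<open>F y\<close> unless \<open>y = 0\<close>.\<close>
  define t where "t = \<delta> / (2 * B)"
  have t: "t > 0" using \<delta> B by (simp add: t_def)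
  define G where "G x = F x + t *\<^sub>R H x" for x
  have G: "linear G" unfolding G_def
    by (intro linear_compose_add F linear_compose_scale_right H)
  have inj: "c = 0 \<and> y = 0" if y: "y \<in> Y" and Gy: "G (c *\<^sub>R z + y) = 0" for c y
  proof -
    have eq: "F y + t *\<^sub>R (c *\<^sub>R H z + H y) = 0"
      using Gy z(1) unfolding G_def by (simp add: linear_add[OF F] linear_scale[OF F] linear_add[OF H] linear_scale[OF H])
    have "z \<bullet> F y = 0" using adj[of z y] z(1) by simp
    then have "t * (c * (z \<bullet> H z) + z \<bullet> H y) = 0"
      using arg_cong[OF eq, of "\<lambda>v. z \<bullet> v"] by (simp add: inner_add_right)
    then have "c * (z \<bullet> H z) = - (z \<bullet> H y)" using t by simp
    then have c: "c = - (z \<bullet> H y) / (z \<bullet> H z)" using z(2) by (metis nonzero_eq_divide_eq)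
    have "c *\<^sub>R H z + H y = K y" unfolding K_def c by simp
    then have "F y = - (t *\<^sub>R K y)" using eq by (simp add: eq_neg_iff_add_eq_0)
    then have "\<delta> * norm y \<le> t * (B * norm y)"
      using order_trans[OF \<delta>(2)[OF y], of "t * (B * norm y)"] B(2)[of y] t by simp
    then have "\<delta> * norm y \<le> \<delta> / 2 * norm y" using B by (simp add: t_def)
    then have "y = 0" using \<delta>(1) by simp
    then show ?thesis using c by (simp add: linear_0[OF H])
  qed
  define Z where "Z = span (insert z Y)"
  have zY: "z \<notin> span Y"
  proof
    assume "z \<in> span Y"
    then have "z \<in> Y" unfolding span_eq_iff[THEN iffD2, OF Y] .
    \<comment> \<open>The zero vector is written as \<open>z + (- z)\<close>, a kernel element with
      coefficient \<open>c = 1\<close>.\<close>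
    then show False using inj[of "- z" 1] subspace_neg[OF Y, of z] by (simp add: linear_0[OF G])
  qed
  have dZ: "dim Z = dim Y + 1" unfolding Z_def dim_span dim_insert using zY by simp
  define W where "W = {x. G x = 0}"
  have W: "subspace W" unfolding W_def using G by (rule linear_subspace_kernel)
  have "W \<inter> Z \<subseteq> {0}"
  proof
    fix x assume x: "x \<in> W \<inter> Z"
    then obtain c where "x - c *\<^sub>R z \<in> span Y" unfolding Z_def using span_breakdown_eq by blast
    then have "x - c *\<^sub>R z \<in> Y" unfolding span_eq_iff[THEN iffD2, OF Y] .
    moreover have "G (c *\<^sub>R z + (x - c *\<^sub>R z)) = 0" using x unfolding W_def by simp
    ultimately have "c = 0 \<and> x - c *\<^sub>R z = 0" by (rule inj)
    then show "x \<in> {0}" by simp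
  qed
  then have "dim (W \<inter> Z) = 0" using dim_subset[of "W \<inter> Z" "{0}"] by simp
  then have "dim W + dim Z \<le> DIM('a)"
    using dim_sums_Int[OF W subspace_span[of "insert z Y"], folded Z_def]
      dim_subset_UNIV[of "{x + y |x y. x \<in> W \<and> y \<in> Z}"] by linarith
  then have "dim W < dim U" using dims dZ by linarith
  then show ?thesis unfolding W_def U_def G_def by blast
qed

text \<open>
  A solution is a negative multiple of a fixed point of the map \<open>z \<mapsto> R\<inverse> (Q z)\<close>, normalised to
  the slice of the cone \<open>R z \<ge> 0\<close> on which the entries of \<open>R z\<close> sum to 1.
\<close>

lemma linear_plus_quadratic_zero:
  fixes R :: "'e \<Rightarrow> 'a::euclidean_space" and Q :: "'e \<Rightarrow> 'a \<Rightarrow> real"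
  assumes E: "finite E" and N: "subspace N" "z0 \<in> N" "z0 \<noteq> 0"
    and inj: "\<And>z. z \<in> N \<Longrightarrow> (\<And>e. e \<in> E \<Longrightarrow> R e \<bullet> z = 0) \<Longrightarrow> z = 0"
    and Q_cont: "\<And>e. continuous_on UNIV (Q e)"
    and Q_nonneg: "\<And>e z. Q e z \<ge> 0"
    and Q_scale: "\<And>e c z. Q e (c *\<^sub>R z) = c\<^sup>2 * Q e z"
    and Q_nonzero: "\<And>z. z \<in> N \<Longrightarrow> z \<noteq> 0 \<Longrightarrow> \<exists>e\<in>E. Q e z \<noteq> 0"
    and Q_image: "\<And>z. z \<in> N \<Longrightarrow> \<exists>y\<in>N. \<forall>e\<in>E. R e \<bullet> y = Q e z"
  shows "\<exists>z\<in>N. z \<noteq> 0 \<and> (\<forall>e\<in>E. R e \<bullet> z + Q e z = 0)"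
proof -
  \<comment> \<open>The normal operator of \<open>R\<close>, which inherits injectivity on
    \<open>N\<close> from \<open>R\<close>.\<close>
  define A where "A z = (\<Sum>e\<in>E. (R e \<bullet> z) *\<^sub>R R e)" for z
  have A: "linear A" unfolding A_def
    by (rule linearI) (simp_all add: inner_add_right scaleR_add_left sum.distrib scaleR_sum_right)
  have A0: "z = 0" if "z \<in> N" "A z = 0" for z
  proof (rule inj[OF that(1)])
    have "(\<Sum>e\<in>E. (R e \<bullet> z)\<^sup>2) = A z \<bullet> z" by (simp add: A_def inner_sum_left power2_eq_square)
    then have "(\<Sum>e\<in>E. (R e \<bullet> z)\<^sup>2) = 0" using that by simp
    then show "R e \<bullet> z = 0" if "e \<in> E" for e using that E by (simp add: sum_nonneg_eq_0_iff)
  qed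
  have "inj_on A N" using A0 linear_injective_on_subspace_0[OF A N(1)] by blast
  then obtain S where S: "range S \<subseteq> N" "linear S" "\<And>v. v \<in> N \<Longrightarrow> S (A v) = v"
    using linear_exists_left_inverse_on[OF A N(1)] by blast
  \<comment> \<open>As \<open>S\<close> inverts \<open>A\<close> on \<open>N\<close>, for
    \<open>z\<close> in \<open>N\<close> this is the solution provided by \<open>Q_image\<close>,
    now chosen continuously in \<open>z\<close>.\<close>
  define T where "T z = S (\<Sum>e\<in>E. Q e z *\<^sub>R R e)" for z
  have TN: "T z \<in> N" for z using S(1) unfolding T_def by blast
  have T: "R e \<bullet> T z = Q e z" if ze: "z \<in> N" "e \<in> E" for z e
  proof -
    obtain y where y: "y \<in> N" "\<And>e. e \<in> E \<Longrightarrow> R e \<bullet> y = Q e z" using Q_image[OF ze(1)] by blast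
    then have "(\<Sum>e\<in>E. Q e z *\<^sub>R R e) = A y" unfolding A_def by simp
    then have "T z = y" using S(3)[OF y(1)] unfolding T_def by simp
    then show ?thesis using y(2) ze(2) by simp
  qed
  have T_cont: "continuous_on X T" for X
    unfolding T_def
    by (rule linear_continuous_on_compose[OF _ S(2)])
      (auto intro!: continuous_intros continuous_on_subset[OF Q_cont])
  define \<sigma> where "\<sigma> z = (\<Sum>e\<in>E. R e \<bullet> z)" for z
  have \<sigma>T: "\<sigma> (T z) > 0" if "z \<in> N" "z \<noteq> 0" for z
  proof -
    have "\<sigma> (T z) = (\<Sum>e\<in>E. Q e z)" unfolding \<sigma>_def using T that by simp
    moreover have "(\<Sum>e\<in>E. Q e z) \<noteq> 0" "(\<Sum>e\<in>E. Q e z) \<ge> 0"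
      using Q_nonzero[OF that] E Q_nonneg by (auto simp: sum_nonneg_eq_0_iff sum_nonneg)
    ultimately show ?thesis by linarith
  qed
  define \<Delta> where "\<Delta> = N \<inter> (\<Inter>e\<in>E. {z. R e \<bullet> z \<ge> 0}) \<inter> {z. \<sigma> z = 1}"
  define \<phi> where "\<phi> z = (1 / \<sigma> (T z)) *\<^sub>R T z" for z
  have \<sigma>_scale: "\<sigma> (c *\<^sub>R z) = c * \<sigma> z" for c z by (simp add: \<sigma>_def sum_distrib_left)
  have \<phi>: "\<phi> z \<in> \<Delta>" if z: "z \<in> N" "z \<noteq> 0" for z
    using \<sigma>T[OF z] T[OF z(1)] Q_nonneg subspace_scale[OF N(1) TN]
    unfolding \<Delta>_def \<phi>_def by (auto simp: \<sigma>_scale)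
  have \<Delta>0: "z \<noteq> 0" "z \<in> N" if "z \<in> \<Delta>" for z using that unfolding \<Delta>_def \<sigma>_def by auto
  have \<sigma>_cont: "continuous_on X \<sigma>" for X unfolding \<sigma>_def by (intro continuous_intros)
  have "closed \<Delta>" unfolding \<Delta>_def
    by (intro closed_Int closed_subspace N(1) closed_INT ballI closed_Collect_le closed_Collect_eq
        continuous_intros \<sigma>_cont)
  moreover have "bounded \<Delta>"
  proof -
    obtain B where B: "B > 0" "\<And>y. norm (S y) \<le> B * norm y" using linear_bounded_pos[OF S(2)] by blast
    have "norm z \<le> B * (\<Sum>e\<in>E. norm (R e))" if z: "z \<in> \<Delta>" for z
    proof -
      have le: "\<bar>R e \<bullet> z\<bar> \<le> 1" if "e \<in> E" for e
        using z that E member_le_sum[of e E "\<lambda>e. R e \<bullet> z"] unfolding \<Delta>_def \<sigma>_def by auto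
      have "norm (A z) \<le> (\<Sum>e\<in>E. norm ((R e \<bullet> z) *\<^sub>R R e))" unfolding A_def by (rule norm_sum)
      also have "\<dots> \<le> (\<Sum>e\<in>E. norm (R e))"
        using le by (intro sum_mono) (simp add: mult_left_le_one_le)
      finally have "B * norm (A z) \<le> B * (\<Sum>e\<in>E. norm (R e))" using B(1) by simp
      then show ?thesis using B(2)[of "A z"] S(3)[OF \<Delta>0(2)[OF z]] by simp
    qed
    then show ?thesis by (auto simp: bounded_iff)
  qed
  moreover have "convex \<Delta>"
    unfolding \<Delta>_def \<sigma>_def
    by (intro convex_Int subspace_imp_convex[OF N(1)] convex_INT)
      (auto simp: convex_def inner_add_right sum.distrib sum_distrib_left[symmetric])
  moreover have "continuous_on \<Delta> \<phi>"
    unfolding \<phi>_def using \<sigma>T[OF \<Delta>0(2,1)]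
    by (intro continuous_intros T_cont continuous_on_compose2[OF \<sigma>_cont[of UNIV] T_cont]) force+
  ultimately obtain z where z: "z \<in> \<Delta>" "\<phi> z = z"
    using brouwer[of \<Delta> \<phi>] \<phi>[OF N(2,3)] \<phi>[OF \<Delta>0(2,1)]
    by (metis Pi_I compact_eq_bounded_closed empty_iff)
  define c where "c = \<sigma> (T z)"
  have c: "c > 0" unfolding c_def using \<sigma>T[OF \<Delta>0(2,1)[OF z(1)]] .
  have "T z = c *\<^sub>R z"
    using arg_cong[OF z(2), of "\<lambda>v. c *\<^sub>R v"] c unfolding \<phi>_def c_def[symmetric] by simp
  then have Qz: "Q e z = c * (R e \<bullet> z)" if "e \<in> E" for e
    using T[OF \<Delta>0(2)[OF z(1)] that] by simp
  \<comment> \<open>The linear term scales with the factor and the quadratic one with its square, so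
    the factor \<open>- 1 / c\<close> makes them cancel.\<close>
  define w where "w = (- 1 / c) *\<^sub>R z"
  have "R e \<bullet> w + Q e w = 0" if "e \<in> E" for e
    unfolding w_def Q_scale Qz[OF that] using c by (simp add: power2_eq_square field_simps)
  moreover have "w \<noteq> 0" "w \<in> N" unfolding w_def using \<Delta>0[OF z(1)] c subspace_scale[OF N(1), of z "- 1 / c"] by auto
  ultimately show ?thesis by blast
qed

section \<open>Stresses and rigidity\<close>

lemma derivation_add: "derivation D \<Longrightarrow> D (x + y) = D x + D y"
  and derivation_mult: "derivation D \<Longrightarrow> D (x * y) = x * D y + D x * y"
  by (simp_all add: derivation_def)

lemma derivation_0: "derivation D \<Longrightarrow> D 0 = 0"
  using derivation_add[of D 0 0] by simp

lemma derivation_sum: "derivation D \<Longrightarrow> D (\<Sum>k\<in>A. f k) = (\<Sum>k\<in>A. D (f k))"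
  by (induction A rule: infinite_finite_induct) (auto simp: derivation_0 derivation_add)

lemma derivation_minus: "derivation D \<Longrightarrow> D (- x) = - D x"
  using derivation_add[of D x "- x"] by (simp add: derivation_0)

lemma derivation_Ints:
  assumes D: "derivation D" and "x \<in> \<int>"
  shows "D x = 0"
proof -
  have D1: "D 1 = 0" using derivation_mult[OF D, of 1 1] by simp
  have Dn: "D (of_nat n) = 0" for n
    by (induction n) (simp_all add: derivation_0[OF D] derivation_add[OF D] D1)
  obtain k where "x = of_int k" using \<open>x \<in> \<int>\<close> by (rule Ints_cases)
  then show ?thesis
    by (cases k rule: int_cases2) (simp_all add: Dn derivation_minus[OF D])
qed

section \<open>Edge vectors, rigidity matrix and Laplacian\<close>

definition edge_diff :: "('e \<Rightarrow> 'v::finite \<Rightarrow> real) \<Rightarrow> 'e \<Rightarrow> real ^ 'd ^ 'v \<Rightarrow> real ^ 'd::finite" where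
  "edge_diff inc e z = (\<Sum>v\<in>UNIV. inc e v *\<^sub>R z $ v)"

text \<open>Half the gradient at \<open>q\<close> of the squared length of the edge
  \<open>e\<close>; \<open>g e\<close> is the fixed lattice part of the edge vector.\<close>

definition rigidity_row ::
  "('e \<Rightarrow> 'v::finite \<Rightarrow> real) \<Rightarrow> ('e \<Rightarrow> real ^ 'd) \<Rightarrow> real ^ 'd ^ 'v \<Rightarrow> 'e \<Rightarrow> real ^ 'd::finite ^ 'v" where
  "rigidity_row inc g q e = (\<chi> v. inc e v *\<^sub>R (edge_diff inc e q + g e))"

text \<open>The weighted Laplacian acting on each spatial coordinate separately.\<close>

definition lap ::
  "'e set \<Rightarrow> ('e \<Rightarrow> 'v::finite \<Rightarrow> real) \<Rightarrow> ('e \<Rightarrow> real) \<Rightarrow> real ^ 'd ^ 'v \<Rightarrow> real ^ 'd::finite ^ 'v" where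
  "lap E inc w z = (\<chi> v. \<Sum>e\<in>E. (w e * inc e v) *\<^sub>R edge_diff inc e z)"

text \<open>The constant term of the equilibrium equation, which is affine in the configuration
  because the lattice is fixed.\<close>

definition load ::
  "'e set \<Rightarrow> ('e \<Rightarrow> 'v::finite \<Rightarrow> real) \<Rightarrow> ('e \<Rightarrow> real ^ 'd) \<Rightarrow> ('e \<Rightarrow> real) \<Rightarrow> real ^ 'd::finite ^ 'v" where
  "load E inc g w = (\<chi> v. \<Sum>e\<in>E. (w e * inc e v) *\<^sub>R g e)"

abbreviation constant_vec :: "'a ^ 'v \<Rightarrow> bool" where
  "constant_vec z \<equiv> \<exists>x. \<forall>v. z $ v = x"

lemma linear_edge_diff: "linear (edge_diff inc e)"
  unfolding edge_diff_def
  by (rule linearI) (simp_all add: scaleR_add_right sum.distrib scaleR_sum_right mult.commute)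

lemmas edge_diff_add = linear_add[OF linear_edge_diff]
  and edge_diff_diff = linear_diff[OF linear_edge_diff]
  and edge_diff_scale = linear_scale[OF linear_edge_diff]

lemma edge_diff_inner: "edge_diff inc e z \<bullet> x = (\<Sum>v\<in>UNIV. inc e v * (z $ v \<bullet> x))"
  by (simp add: edge_diff_def inner_sum_left)

lemma inner_vec_lambda: "(\<chi> v. f v) \<bullet> y = (\<Sum>v\<in>UNIV. f v \<bullet> (y $ v))"
  by (simp add: inner_vec_def)

lemma rigidity_row_inner:
  "rigidity_row inc g q e \<bullet> z = (edge_diff inc e q + g e) \<bullet> edge_diff inc e z"
  unfolding inner_commute[of "edge_diff inc e q + g e"] edge_diff_inner rigidity_row_def inner_vec_lambda
  by (simp add: inner_commute)

lemma lap_inner: "lap E inc w z \<bullet> y = (\<Sum>e\<in>E. w e * (edge_diff inc e z \<bullet> edge_diff inc e y))"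
proof -
  have "lap E inc w z \<bullet> y = (\<Sum>v\<in>UNIV. \<Sum>e\<in>E. w e * (inc e v * (y $ v \<bullet> edge_diff inc e z)))"
    unfolding lap_def inner_vec_lambda inner_sum_left by (simp add: mult.assoc inner_commute)
  also have "\<dots> = (\<Sum>e\<in>E. w e * (edge_diff inc e y \<bullet> edge_diff inc e z))"
    by (subst sum.swap) (simp add: edge_diff_inner sum_distrib_left)
  finally show ?thesis by (simp add: inner_commute)
qed

lemma load_inner: "load E inc g w \<bullet> y = (\<Sum>e\<in>E. w e * (g e \<bullet> edge_diff inc e y))"
proof -
  have "load E inc g w \<bullet> y = (\<Sum>v\<in>UNIV. \<Sum>e\<in>E. w e * (inc e v * (y $ v \<bullet> g e)))"
    unfolding load_def inner_vec_lambda inner_sum_left by (simp add: mult.assoc inner_commute)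
  also have "\<dots> = (\<Sum>e\<in>E. w e * (edge_diff inc e y \<bullet> g e))"
    by (subst sum.swap) (simp add: edge_diff_inner sum_distrib_left)
  finally show ?thesis by (simp add: inner_commute)
qed

text \<open>The equilibrium expression is the transposed rigidity matrix applied to
  \<open>w\<close>, so stresses are the linear relations between the rows.\<close>

lemma lap_load_inner:
  "(lap E inc w q + load E inc g w) \<bullet> z = (\<Sum>e\<in>E. w e * (rigidity_row inc g q e \<bullet> z))"
  by (simp add: inner_add_left lap_inner load_inner rigidity_row_inner distrib_left sum.distrib)

lemma linear_lap: "linear (lap E inc w :: real ^ 'd::finite ^ 'v::finite \<Rightarrow> _)"
proof (rule linearI)
  show "lap E inc w (x + y) = lap E inc w x + lap E inc w y" for x y :: "real ^ 'd ^ 'v"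
    by (simp add: lap_def vec_eq_iff edge_diff_add distrib_left sum.distrib)
  show "lap E inc w (c *\<^sub>R x) = c *\<^sub>R lap E inc w x" for c and x :: "real ^ 'd ^ 'v"
    by (simp add: lap_def vec_eq_iff edge_diff_scale sum_distrib_left algebra_simps)
qed

lemma lap_self_adjoint: "lap E inc w x \<bullet> y = x \<bullet> lap E inc w y"
  unfolding inner_commute[of x] lap_inner by (simp add: inner_commute)

lemma lap_add_scale: "lap E inc (\<lambda>e. w e + t * w' e) z = lap E inc w z + t *\<^sub>R lap E inc w' z"
  by (simp add: lap_def vec_eq_iff sum.distrib sum_distrib_left algebra_simps)

lemma load_add_scale: "load E inc g (\<lambda>e. w e + t * w' e) = load E inc g w + t *\<^sub>R load E inc g w'"
  by (simp add: load_def vec_eq_iff sum.distrib sum_distrib_left algebra_simps)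

definition map_vec2 :: "(real \<Rightarrow> real) \<Rightarrow> real ^ 'd ^ 'v \<Rightarrow> real ^ 'd ^ 'v" where
  "map_vec2 D z = (\<chi> v i. D (z $ v $ i))"

lemma map_vec2_nth [simp]: "map_vec2 D z $ v $ i = D (z $ v $ i)"
  by (simp add: map_vec2_def)

text \<open>Genericity enters as the existence of a derivation with any prescribed value at
  \<open>p\<close> that kills the offsets. Integral incidences are killed by every derivation, and
  zero row sums make constant displacements invisible to the edges.\<close>

locale incidence_framework =
  fixes E :: "'e set" and inc :: "'e \<Rightarrow> 'v::finite \<Rightarrow> real" and g :: "'e \<Rightarrow> real ^ 'd::finite"
    and p :: "real ^ 'd ^ 'v"
  assumes finite_E: "finite E"
    and inc_Ints: "inc e v \<in> \<int>"
    and inc_sum: "(\<Sum>v\<in>UNIV. inc e v) = 0"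
    and generic_derivation: "\<exists>D. derivation D \<and> map_vec2 D p = p' \<and> (\<forall>e\<in>E. \<forall>i. D (g e $ i) = 0)"
begin

abbreviation "\<delta> \<equiv> edge_diff inc"
abbreviation "\<Lambda> \<equiv> lap E inc"
abbreviation "\<rho> \<equiv> rigidity_row inc g p"
abbreviation "stress w q \<equiv> \<Lambda> w q + load E inc g w = 0"
abbreviation "same_lengths q \<equiv> \<forall>e\<in>E. norm (\<delta> e q + g e) = norm (\<delta> e p + g e)"

lemma edge_diff_constant: "constant_vec z \<Longrightarrow> \<delta> e z = 0"
  using inc_sum[of e] by (auto simp: edge_diff_def simp flip: scaleR_sum_left)

section \<open>Differentiating equilibrium equations and lengths\<close>

lemma derivation_edge_diff:
  assumes D: "derivation D"
  shows "D (\<delta> e z $ i) = \<delta> e (map_vec2 D z) $ i"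
  by (simp add: edge_diff_def derivation_sum[OF D] derivation_mult[OF D]
      derivation_Ints[OF D inc_Ints])

lemma derivation_lap:
  assumes D: "derivation D"
  shows "map_vec2 D (\<Lambda> w z) = \<Lambda> (D \<circ> w) z + \<Lambda> w (map_vec2 D z)"
  by (simp add: lap_def vec_eq_iff derivation_sum[OF D]
      derivation_mult[OF D] derivation_Ints[OF D inc_Ints] derivation_edge_diff[OF D]
      sum.distrib algebra_simps)

lemma derivation_load:
  assumes D: "derivation D" and Dg: "\<forall>e\<in>E. \<forall>i. D (g e $ i) = 0"
  shows "map_vec2 D (load E inc g w) = load E inc g (D \<circ> w)"
  using Dg by (simp add: load_def vec_eq_iff derivation_sum[OF D]
      derivation_mult[OF D] derivation_Ints[OF D inc_Ints])

lemma map_vec2_0: "derivation D \<Longrightarrow> map_vec2 D 0 = 0"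
  by (simp add: vec_eq_iff derivation_0)

lemma map_vec2_add: "derivation D \<Longrightarrow> map_vec2 D (x + y) = map_vec2 D x + map_vec2 D y"
  by (simp add: vec_eq_iff derivation_add)

text \<open>The weights are in general not constants of \<open>D\<close>, so differentiating the
  equilibrium produces \<open>D \<circ> w\<close>; its failure to be a stress is measured by the
  Laplacian of \<open>w\<close> at the velocity \<open>p'\<close>.\<close>

lemma derivation_stress:
  assumes w: "stress w p"
  obtains D where "derivation D" "\<Lambda> (D \<circ> w) p + load E inc g (D \<circ> w) + \<Lambda> w p' = 0"
proof -
  obtain D where D: "derivation D" "map_vec2 D p = p'" "\<forall>e\<in>E. \<forall>i. D (g e $ i) = 0"
    using generic_derivation by blast
  have "map_vec2 D (\<Lambda> w p + load E inc g w) = 0" unfolding w by (rule map_vec2_0[OF D(1)])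
  then have "\<Lambda> (D \<circ> w) p + load E inc g (D \<circ> w) + \<Lambda> w p' = 0"
    unfolding map_vec2_add[OF D(1)] derivation_lap[OF D(1)] derivation_load[OF D(1,3)] D(2)
    by (simp add: algebra_simps)
  then show thesis using that D(1) by blast
qed

text \<open>Differentiate \<open>\<Lambda> w z = 0\<close> and pair with \<open>z\<close>: the term
  with \<open>map_vec2 D z\<close> drops out by self-adjointness, as \<open>z\<close> is in the
  kernel.\<close>

lemma derivation_kernel_lap:
  assumes D: "derivation D" and z: "\<Lambda> w z = 0"
  shows "\<Lambda> (D \<circ> w) z \<bullet> z = 0"
proof -
  have "\<Lambda> (D \<circ> w) z + \<Lambda> w (map_vec2 D z) = 0"
    unfolding derivation_lap[OF D, symmetric] z by (rule map_vec2_0[OF D])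
  then have "\<Lambda> (D \<circ> w) z \<bullet> z + \<Lambda> w (map_vec2 D z) \<bullet> z = 0"
    by (metis inner_add_left inner_zero_left)
  then show ?thesis using z by (simp add: lap_self_adjoint)
qed

lemma derivation_norm:
  assumes D: "derivation D" and Dg: "\<forall>e\<in>E. \<forall>i. D (g e $ i) = 0" and e: "e \<in> E"
  shows "D ((norm (\<delta> e q + g e))\<^sup>2) = 2 * ((\<delta> e q + g e) \<bullet> \<delta> e (map_vec2 D q))"
  using Dg e
  by (simp add: power2_norm_eq_inner inner_vec_def derivation_sum[OF D] derivation_mult[OF D]
      derivation_add[OF D] derivation_edge_diff[OF D] sum_distrib_left mult.commute)

text \<open>Pairing the differentiated equilibrium with a motion \<open>z\<close> shows that
  \<open>z\<close> is orthogonal to \<open>\<Lambda> w p'\<close> for every velocity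
  \<open>p'\<close>. By self-adjointness \<open>z\<close> is in the kernel.\<close>

lemma infinitesimally_rigid_of_stress:
  assumes w: "stress w p" and ker: "\<And>z :: real ^ 'd ^ 'v. \<Lambda> w z = 0 \<Longrightarrow> constant_vec z"
    and z: "\<And>e. e \<in> E \<Longrightarrow> \<rho> e \<bullet> z = 0"
  shows "constant_vec z"
proof (rule ker)
  have "\<Lambda> w z \<bullet> p' = 0" for p'
  proof -
    obtain D where D: "\<Lambda> (D \<circ> w) p + load E inc g (D \<circ> w) + \<Lambda> w p' = 0"
      using derivation_stress[OF w] by blast
    have "(\<Lambda> (D \<circ> w) p + load E inc g (D \<circ> w)) \<bullet> z = 0"
      unfolding lap_load_inner using z by simp
    then have "\<Lambda> w p' \<bullet> z = 0" using arg_cong[OF D, of "\<lambda>y. y \<bullet> z"] by (simp add: inner_add_left)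
    then show ?thesis by (metis lap_self_adjoint inner_commute)
  qed
  then show "\<Lambda> w z = 0" using inner_eq_zero_iff by blast
qed

text \<open>
  A derivation turns the equal lengths of \<open>p\<close> and \<open>q\<close> into an inclusion of the column spaces of
  their rigidity matrices, which is an equality because the one of \<open>p\<close> has maximal rank.
\<close>

lemma stress_transfer:
  assumes rigid: "\<And>z. (\<And>e. e \<in> E \<Longrightarrow> \<rho> e \<bullet> z = 0) \<Longrightarrow> constant_vec z"
    and q: "same_lengths q" and w: "stress w p"
  shows "stress w q"
proof -
  \<comment> \<open>An arbitrary vertex; pinning it at 0 removes the translations.\<close>
  define v0 where "v0 = (undefined :: 'v)"
  define N where "N = {z :: real ^ 'd ^ 'v. z $ v0 = 0}"
  have N: "subspace N" unfolding N_def subspace_def by simp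
  have ex: "\<exists>z'\<in>N. \<forall>e\<in>E. rigidity_row inc g q e \<bullet> z' = \<rho> e \<bullet> z" for z
  proof -
    obtain D where D: "derivation D" "map_vec2 D p = z" "\<forall>e\<in>E. \<forall>i. D (g e $ i) = 0"
      using generic_derivation by blast
    define z' where "z' = map_vec2 D q - (\<chi> v. map_vec2 D q $ v0)"
    have "\<delta> e z' = \<delta> e (map_vec2 D q)" for e
      unfolding z'_def edge_diff_diff by (subst edge_diff_constant[of "\<chi> v. _"]) auto
    then have "rigidity_row inc g q e \<bullet> z' = \<rho> e \<bullet> z" if "e \<in> E" for e
      using derivation_norm[OF D(1,3) that, of p] derivation_norm[OF D(1,3) that, of q] q that D(2)
      unfolding rigidity_row_inner by simp
    moreover have "z' \<in> N" by (simp add: N_def z'_def)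
    ultimately show ?thesis by blast
  qed
  obtain h0 where h0: "\<And>z. h0 z \<in> N" "\<And>z e. e \<in> E \<Longrightarrow> rigidity_row inc g q e \<bullet> h0 z = \<rho> e \<bullet> z"
    using ex by metis
  \<comment> \<open>The choice \<open>h0\<close> need not be linear; its values on a basis of
    \<open>N\<close> determine a linear map \<open>h\<close> with the same property.\<close>
  obtain B where B: "B \<subseteq> N" "independent B" "N \<subseteq> span B" using basis_exists by metis
  obtain h where h: "linear h" "\<forall>b\<in>B. h b = h0 b" using linear_independent_extend[OF B(2)] by blast
  have hrow: "h z \<in> N \<and> (\<forall>e\<in>E. rigidity_row inc g q e \<bullet> h z = \<rho> e \<bullet> z)" if "z \<in> N" for z
    using subsetD[OF B(3) that]
  proof (induction rule: span_induct_alt)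
    case base
    then show ?case using subspace_0[OF N] by (simp add: linear_0[OF h(1)])
  next
    case (step c b y)
    then show ?case using h0 h(2) subspace_add[OF N subspace_scale[OF N]]
      by (simp add: linear_add[OF h(1)] linear_scale[OF h(1)] inner_add_right)
  qed
  \<comment> \<open>Rigidity of \<open>p\<close> makes \<open>h\<close> injective, hence a bijection
    of \<open>N\<close>: the row values of \<open>q\<close> on \<open>N\<close> are row values of
    \<open>p\<close>, for which \<open>w\<close> is a relation.\<close>
  have "z = 0" if "z \<in> N" "h z = 0" for z
  proof -
    have "\<rho> e \<bullet> z = 0" if "e \<in> E" for e using hrow[OF \<open>z \<in> N\<close>] that \<open>h z = 0\<close> by simp
    then obtain x where "\<And>v. z $ v = x" using rigid by blast
    then show ?thesis using that(1) by (simp add: N_def vec_eq_iff)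
  qed
  then have "inj_on h (span N)" using linear_injective_on_subspace_0[OF h(1) N]
    unfolding span_eq_iff[THEN iffD2, OF N] by blast
  then have "dim (h ` N) = dim N" by (rule dim_image_eq[OF h(1)])
  moreover have "h ` N \<subseteq> N" using hrow by blast
  ultimately have hN: "h ` N = N"
    using subspace_dim_equal[OF linear_subspace_image[OF h(1) N] N] by simp
  have "(\<Lambda> w q + load E inc g w) \<bullet> z = 0" for z
  proof -
    define z' where "z' = z - (\<chi> v. z $ v0)"
    have "\<delta> e z = \<delta> e z'" for e
      unfolding z'_def edge_diff_diff by (subst edge_diff_constant[of "\<chi> v. _"]) auto
    moreover have "z' \<in> N" by (simp add: N_def z'_def)
    then obtain y where "y \<in> N" "z' = h y" using hN by blast
    ultimately have "(\<Lambda> w q + load E inc g w) \<bullet> z = (\<Sum>e\<in>E. w e * (\<rho> e \<bullet> y))"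
      unfolding lap_load_inner rigidity_row_inner[of _ _ _ _ z] using hrow
      by (simp add: rigidity_row_inner)
    also have "\<dots> = (\<Lambda> w p + load E inc g w) \<bullet> y" by (rule lap_load_inner[symmetric])
    finally show ?thesis using w by simp
  qed
  then show ?thesis using inner_eq_zero_iff by blast
qed

text \<open>Both \<open>p\<close> and \<open>q\<close> solve the affine equilibrium equation of
  \<open>w\<close>, so their difference lies in the kernel of its linear part.\<close>

lemma globally_rigid_of_stress:
  assumes w: "stress w p" and ker: "\<And>z :: real ^ 'd ^ 'v. \<Lambda> w z = 0 \<Longrightarrow> constant_vec z"
    and q: "same_lengths q"
  shows "constant_vec (q - p)"
proof (rule ker)
  have "stress w q"
    using stress_transfer[OF infinitesimally_rigid_of_stress[OF w ker] q w] .
  then show "\<Lambda> w (q - p) = 0"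
    using w by (metis add_right_cancel linear_diff[OF linear_lap] right_minus_eq)
qed

text \<open>
  If \<open>\<zeta> q\<close> is an infinitesimal motion of \<open>q\<close>, then \<open>q + t \<zeta> q\<close> and \<open>q - t \<zeta> q\<close> have the same edge
  lengths; Brouwer's theorem provides a \<open>q\<close> for which the first of them is \<open>p\<close>.
\<close>

lemma not_globally_rigid_of_flex:
  assumes cont: "continuous_on UNIV \<zeta>"
    and flex: "\<And>q e. e \<in> E \<Longrightarrow> rigidity_row inc g q e \<bullet> \<zeta> q = 0"
    and v: "\<And>q. \<zeta> q $ v = 0" and u: "\<zeta> p $ u $ i \<noteq> 0"
  shows "\<exists>q. same_lengths q \<and> \<not> constant_vec (q - p)"
proof -
  have "continuous_on UNIV (\<lambda>q. \<zeta> q $ u $ i)" using cont by (intro continuous_intros)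
  then have "open ((\<lambda>q. \<zeta> q $ u $ i) -` (- {0}))"
    by (intro open_vimage) auto
  \<comment> \<open>On this ball the flex keeps coordinate \<open>i\<close> of \<open>u\<close>
    nonzero, so it is nontrivial at the fixed point found below.\<close>
  then obtain r where r: "r > 0" "cball p r \<subseteq> (\<lambda>q. \<zeta> q $ u $ i) -` (- {0})"
    using u unfolding open_contains_cball by force
  have "bounded (\<zeta> ` cball p r)"
    by (intro compact_imp_bounded compact_continuous_image continuous_on_subset[OF cont]) auto
  then obtain M where M: "M > 0" "\<And>q. q \<in> cball p r \<Longrightarrow> norm (\<zeta> q) \<le> M"
    unfolding bounded_pos by blast
  define t where "t = r / M"
  have t: "t > 0" using r M by (simp add: t_def)
  obtain q where q: "q \<in> cball p r" "p - t *\<^sub>R \<zeta> q = q"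
  proof (rule brouwer[of "cball p r" "\<lambda>q. p - t *\<^sub>R \<zeta> q"])
    show "(\<lambda>q. p - t *\<^sub>R \<zeta> q) \<in> cball p r \<rightarrow> cball p r"
    proof
      fix q assume "q \<in> cball p r"
      then have "t * norm (\<zeta> q) \<le> t * M" using M t by (intro mult_left_mono) auto
      then show "p - t *\<^sub>R \<zeta> q \<in> cball p r" using M(1) r(1) by (simp add: dist_norm t_def)
    qed
    show "continuous_on (cball p r) (\<lambda>q. p - t *\<^sub>R \<zeta> q)"
      by (intro continuous_intros continuous_on_subset[OF cont]) auto
  qed (use r in auto)
  define q' where "q' = q - t *\<^sub>R \<zeta> q"
  have p: "p = q + t *\<^sub>R \<zeta> q" using q(2) by (simp add: algebra_simps)
  have "norm (\<delta> e q' + g e) = norm (\<delta> e p + g e)" if "e \<in> E" for e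
  proof -
    define x where "x = \<delta> e q + g e"
    define y where "y = \<delta> e (\<zeta> q)"
    have xy: "x \<bullet> y = 0" using flex[OF that, of q] unfolding rigidity_row_inner x_def y_def .
    have "\<delta> e q' + g e = x - t *\<^sub>R y" "\<delta> e p + g e = x + t *\<^sub>R y"
      unfolding p q'_def x_def y_def by (simp_all add: edge_diff_add edge_diff_diff edge_diff_scale)
    moreover have "norm (x - t *\<^sub>R y) = norm (x + t *\<^sub>R y)"
      using xy by (simp add: norm_eq inner_simps inner_commute)
    ultimately show ?thesis by simp
  qed
  moreover have "\<not> constant_vec (q' - p)"
  proof
    assume "constant_vec (q' - p)"
    then obtain x where x: "\<And>v. (q' - p) $ v = x" by blast
    \<comment> \<open>This displacement is 0 at \<open>v\<close> and nonzero at \<open>u\<close>,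
      hence not a translation.\<close>
    have d: "q' - p = - ((2 * t) *\<^sub>R \<zeta> q)" unfolding p q'_def by (simp add: algebra_simps scaleR_2[symmetric])
    have "x = 0" using x[of v] v unfolding d by simp
    then have "\<zeta> q $ u = 0" using x[of u] t unfolding d by simp
    then show False using r(2) q(1) by auto
  qed
  ultimately show ?thesis by blast
qed

lemma stress_of_globally_rigid:
  assumes rigid: "\<And>z. (\<And>e. e \<in> E \<Longrightarrow> \<rho> e \<bullet> z = 0) \<Longrightarrow> constant_vec z"
    and glob: "\<And>q. same_lengths q \<Longrightarrow> constant_vec (q - p)"
  shows "\<exists>w. stress w p \<and> (\<forall>z :: real ^ 'd ^ 'v. \<Lambda> w z = 0 \<longrightarrow> constant_vec z)"
proof -
  define k where "k w = dim {z :: real ^ 'd ^ 'v. \<Lambda> w z = 0}" for w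
  have "stress (\<lambda>_. 0) p" by (simp add: lap_def load_def vec_eq_iff)
  then obtain w where w: "stress w p" and min: "\<And>w'. stress w' p \<Longrightarrow> k w \<le> k w'"
    using ex_has_least_nat[of "\<lambda>w. stress w p" _ k] by blast
  have "constant_vec z1" if z1: "\<Lambda> w z1 = 0" for z1 :: "real ^ 'd ^ 'v"
  proof (rule ccontr)
    assume nc: "\<not> constant_vec z1"
    define v0 where "v0 = (undefined :: 'v)"
    define K where "K = {z :: real ^ 'd ^ 'v. \<Lambda> w z = 0}"
    define N where "N = K \<inter> {z. z $ v0 = 0}"
    have K: "subspace K" unfolding K_def by (rule linear_subspace_kernel[OF linear_lap])
    have N: "subspace N" unfolding N_def by (intro subspace_inter K) (simp add: subspace_def)
    \<comment> \<open>Moves a kernel vector into \<open>N\<close> without changing its edge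
      vectors.\<close>
    define \<nu> where "\<nu> z = z - (\<chi> v. z $ v0)" for z :: "real ^ 'd ^ 'v"
    have \<delta>\<nu>: "\<delta> e (\<nu> z) = \<delta> e z" for e z
      unfolding \<nu>_def edge_diff_diff by (subst edge_diff_constant[of "\<chi> v. _"]) auto
    have \<nu>N: "\<nu> z \<in> N" if "z \<in> K" for z
      using that unfolding N_def K_def by (simp add: lap_def \<delta>\<nu>) (simp add: \<nu>_def)
    have N0: "z = 0" if "z \<in> N" "constant_vec z" for z
      using that unfolding N_def by (auto simp: vec_eq_iff)
    define Q where "Q e z = \<delta> e z \<bullet> \<delta> e z" for e and z :: "real ^ 'd ^ 'v"
    \<comment> \<open>The factor 2 comes from the squared length of an edge of \<open>p + z\<close>,
      which differs from that of \<open>p\<close> by \<open>2 \<rho> z + Q z\<close>.\<close>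
    have image: "\<exists>y\<in>K. \<forall>e\<in>E. (2 *\<^sub>R \<rho> e) \<bullet> y = Q e z" if z: "z \<in> K" for z
    proof (rule solve_linear_system_subspace[OF K finite_E])
      fix \<eta> assume \<eta>: "\<And>y. y \<in> K \<Longrightarrow> (\<Sum>e\<in>E. \<eta> e * ((2 *\<^sub>R \<rho> e) \<bullet> y)) = 0"
      have "- (\<Lambda> \<eta> p + load E inc g \<eta>) \<bullet> y = 0" if "\<Lambda> w y = 0" for y
      proof -
        have "2 * (\<Sum>e\<in>E. \<eta> e * (\<rho> e \<bullet> y)) = 0"
          using \<eta>[of y] that unfolding K_def by (simp add: sum_distrib_left mult.left_commute)
        then show ?thesis unfolding inner_minus_left lap_load_inner by simp
      qed
      \<comment> \<open>The unbalanced force of \<open>\<eta>\<close> is orthogonal to the kernel of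
        \<open>\<Lambda> w\<close>, hence the image of a velocity.\<close>
      then obtain p' where p': "\<Lambda> w p' = - (\<Lambda> \<eta> p + load E inc g \<eta>)"
        using self_adjoint_image[OF linear_lap lap_self_adjoint] by blast
      obtain D where D: "derivation D" "\<Lambda> (D \<circ> w) p + load E inc g (D \<circ> w) + \<Lambda> w p' = 0"
        using derivation_stress[OF w] by blast
      \<comment> \<open>\<open>\<eta>\<close> and \<open>D \<circ> w\<close> fail the equilibrium
        equation by the same vector, so their difference is a stress.\<close>
      define \<theta> where "\<theta> = (\<lambda>e. \<eta> e + (- 1) * (D \<circ> w) e)"
      have \<theta>: "stress \<theta> p"
        using D(2) unfolding p' \<theta>_def lap_add_scale load_add_scale
        by (simp add: algebra_simps del: comp_apply)
      \<comment> \<open>Otherwise adding a multiple of \<open>\<theta>\<close> to \<open>w\<close>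
        would give a stress of smaller nullity.\<close>
      have "z \<bullet> \<Lambda> \<theta> z = 0"
      proof (rule ccontr)
        assume "z \<bullet> \<Lambda> \<theta> z \<noteq> 0"
        then have "\<exists>t. dim {x :: real ^ 'd ^ 'v. \<Lambda> w x + t *\<^sub>R \<Lambda> \<theta> x = 0} < dim {x :: real ^ 'd ^ 'v. \<Lambda> w x = 0}"
          using z unfolding K_def
          by (intro kernel_dim_perturb[OF linear_lap linear_lap lap_self_adjoint, where z = z]) auto
        then obtain t where t: "dim {x :: real ^ 'd ^ 'v. \<Lambda> w x + t *\<^sub>R \<Lambda> \<theta> x = 0} < k w"
          unfolding k_def by blast
        have "stress (\<lambda>e. w e + t * \<theta> e) p"
        proof -
          have "\<Lambda> (\<lambda>e. w e + t * \<theta> e) p + load E inc g (\<lambda>e. w e + t * \<theta> e)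
            = (\<Lambda> w p + load E inc g w) + t *\<^sub>R (\<Lambda> \<theta> p + load E inc g \<theta>)"
            unfolding lap_add_scale load_add_scale by (simp add: algebra_simps)
          then show ?thesis using w \<theta> by simp
        qed
        from min[OF this] t show False unfolding k_def lap_add_scale by simp
      qed
      moreover have "\<Lambda> (D \<circ> w) z \<bullet> z = 0"
        using derivation_kernel_lap[OF D(1)] z unfolding K_def by blast
      ultimately have "\<Lambda> \<eta> z \<bullet> z = 0"
        unfolding \<theta>_def lap_add_scale by (simp add: inner_diff_right inner_commute comp_def)
      then show "(\<Sum>e\<in>E. \<eta> e * Q e z) = 0" unfolding lap_inner Q_def .
    qed
    have "\<exists>z\<in>N. z \<noteq> 0 \<and> (\<forall>e\<in>E. (2 *\<^sub>R \<rho> e) \<bullet> z + Q e z = 0)"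
    proof (rule linear_plus_quadratic_zero[OF finite_E N])
      show "\<nu> z1 \<in> N" using \<nu>N z1 by (simp add: K_def)
      show "\<nu> z1 \<noteq> 0" using nc unfolding \<nu>_def by (auto simp: vec_eq_iff)
      show "z = 0" if "z \<in> N" "\<And>e. e \<in> E \<Longrightarrow> (2 *\<^sub>R \<rho> e) \<bullet> z = 0" for z
        using N0[OF that(1)] rigid that(2) by simp
      show "continuous_on UNIV (Q e)" for e
        unfolding Q_def by (intro continuous_intros linear_continuous_on)
          (auto simp: linear_edge_diff simp flip: linear_conv_bounded_linear)
      show "Q e z \<ge> 0" for e z by (simp add: Q_def)
      show "Q e (c *\<^sub>R z) = c\<^sup>2 * Q e z" for e c z
        by (simp add: Q_def edge_diff_scale power2_eq_square)
      show "\<exists>e\<in>E. Q e z \<noteq> 0" if "z \<in> N" "z \<noteq> 0" for z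
      proof (rule ccontr)
        assume "\<not> (\<exists>e\<in>E. Q e z \<noteq> 0)"
        then have "\<rho> e \<bullet> z = 0" if "e \<in> E" for e
          using that by (simp add: Q_def rigidity_row_inner)
        then show False using rigid N0 that by blast
      qed
      show "\<exists>y\<in>N. \<forall>e\<in>E. (2 *\<^sub>R \<rho> e) \<bullet> y = Q e z" if zN: "z \<in> N" for z
      proof -
        obtain y where "y \<in> K" "\<forall>e\<in>E. (2 *\<^sub>R \<rho> e) \<bullet> y = Q e z"
          using image[of z] zN unfolding N_def by blast
        then show ?thesis using \<nu>N by (intro bexI[of _ "\<nu> y"]) (auto simp: rigidity_row_inner \<delta>\<nu>)
      qed
    qed
    then obtain z where z: "z \<in> N" "z \<noteq> 0" "\<And>e. e \<in> E \<Longrightarrow> (2 *\<^sub>R \<rho> e) \<bullet> z + Q e z = 0" by blast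
    have "norm (\<delta> e (p + z) + g e) = norm (\<delta> e p + g e)" if "e \<in> E" for e
      using z(3)[OF that] unfolding inner_scaleR_left rigidity_row_inner Q_def
      by (simp add: norm_eq edge_diff_add inner_simps inner_commute)
    then have "constant_vec (p + z - p)" by (intro glob) blast
    then show False using N0[OF z(1)] z(2) by simp
  qed
  then show ?thesis using w by blast
qed

end

section \<open>Gain graphs\<close>

lemma framework_coords_simps [simp]:
  "framework_coords p L (Inl (v, i)) = p v $ i"
  "framework_coords p L (Inr (i, j)) = L $ i $ j"
  by (simp_all add: framework_coords_def)

text \<open>The determinant is an integer polynomial in the entries of \<open>L\<close> that does
  not vanish at the identity matrix.\<close>

lemma generic_lattice_invertible:
  fixes p :: "'v::finite \<Rightarrow> real ^ 'd::finite"
  assumes "generic_framework p L"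
  shows "invertible L"
proof -
  define f where "f a = det (\<chi> i j. a (Inr (i, j)))" for a :: "('v \<times> 'd) + ('d \<times> 'd) \<Rightarrow> real"
  have "rat_poly_fun f"
    unfolding f_def det_def by (intro rat_poly_fun_sum rat_poly_fun_mult rat_poly_fun_prod) simp_all
  moreover have "f (framework_coords (\<lambda>_. 0) (mat 1)) \<noteq> 0"
    by (simp add: f_def)
  ultimately have "f (framework_coords p L) \<noteq> 0"
    using rat_poly_fun_eq_0 assms unfolding generic_framework_def by blast
  then have "det L \<noteq> 0" by (simp add: f_def)
  then show ?thesis by (simp add: invertible_det_nz)
qed

text \<open>The equation \<open>L = M ** L\<close> forces \<open>M\<close> to be the identity,
  leaving only translations.\<close>

lemma congruent_same_lattice_iff:
  assumes "invertible L"
  shows "congruent_frameworks p L q L \<longleftrightarrow> (\<exists>x. \<forall>v. q v = p v + x)"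
proof
  assume "congruent_frameworks p L q L"
  then obtain M x where M: "\<And>v. q v = M *v p v + x" "L = M ** L"
    unfolding congruent_frameworks_def by blast
  obtain L' where "L ** L' = mat 1" using assms unfolding invertible_def by blast
  then have "M = mat 1" using M(2) by (metis matrix_mul_assoc matrix_mul_rid)
  then show "\<exists>x. \<forall>v. q v = p v + x" using M(1) by auto
next
  assume "\<exists>x. \<forall>v. q v = p v + x"
  then obtain x where "\<forall>v. q v = p v + x" by blast
  then show "congruent_frameworks p L q L"
    unfolding congruent_frameworks_def
    by (intro exI[of _ "mat 1"] exI[of _ x]) (simp add: orthogonal_matrix_id)
qed

lemma lattice_vec_uminus: "lattice_vec L (- \<gamma>) = - lattice_vec L \<gamma>"
  by (simp add: lattice_vec_def vec_eq_iff matrix_vector_mult_def sum_negf)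

lemma lattice_vec_nth: "lattice_vec L \<gamma> $ i = (\<Sum>j\<in>UNIV. L $ i $ j * of_int (\<gamma> $ j))"
  by (simp add: lattice_vec_def matrix_vector_mult_def)

lemma continuous_on_rat_poly_fun:
  fixes f :: "(('v::finite \<times> 'd::finite) + ('d \<times> 'd) \<Rightarrow> real) \<Rightarrow> real"
  assumes "rat_poly_fun f"
  shows "continuous_on UNIV (\<lambda>q. f (framework_coords (($) q) L))"
proof -
  obtain P where "f = (\<lambda>a. eval_rat_mpoly a P)" using assms unfolding rat_poly_fun_def by blast
  moreover have "continuous_on UNIV (\<lambda>q. framework_coords (($) q) L k)" for k :: "('v \<times> 'd) + ('d \<times> 'd)"
    by (cases k) (auto simp: framework_coords_def intro!: continuous_intros)
  ultimately show ?thesis by (auto simp: eval_rat_mpoly_def intro!: continuous_intros)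
qed

section \<open>From gain graphs to incidence frameworks\<close>

locale generic_gain_framework =
  fixes E :: "('v::finite, 'd::finite) edge set"
    and rep :: "('v, 'd) edge \<Rightarrow> ('v, 'd) triple"
    and p :: "'v \<Rightarrow> real ^ 'd"
    and L :: "real ^ 'd ^ 'd"
  assumes gain_graph: "gain_graph E"
    and rep: "e \<in> E \<Longrightarrow> rep e \<in> e"
    and generic: "generic_framework p L"
begin

abbreviation "inc \<equiv> incidence rep"
abbreviation "offset L' e \<equiv> lattice_vec L' (snd (snd (rep e)))"

lemma sum_incidence:
  fixes f :: "'v \<Rightarrow> 'a::real_vector"
  assumes "rep e = (u, v, \<gamma>)"
  shows "(\<Sum>x\<in>UNIV. inc e x *\<^sub>R f x) = f v - f u"
proof (cases "u = v")
  case True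
  then show ?thesis using assms by (simp add: incidence_def)
next
  case False
  have "(\<Sum>x\<in>UNIV. inc e x *\<^sub>R f x) = (\<Sum>x\<in>UNIV. (if x = v then f x else 0) - (if x = u then f x else 0))"
    using False assms by (intro sum.cong) (auto simp: incidence_def)
  then show ?thesis by (simp add: sum_subtractf)
qed

lemma edge_diff_incidence: "rep e = (u, v, \<gamma>) \<Longrightarrow> edge_diff inc e z = z $ v - z $ u"
  unfolding edge_diff_def by (rule sum_incidence)

text \<open>Reversal is the only identification, so conditions on all triples of an edge reduce to
  its representative.\<close>

lemma edge_eq:
  assumes "e \<in> E" "rep e = (u, v, \<gamma>)"
  shows "e = {(u, v, \<gamma>), (v, u, - \<gamma>)}"
proof -
  have "e \<in> UNIV // gain_equiv" using gain_graph assms(1) unfolding gain_graph_def by blast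
  moreover have "(u, v, \<gamma>) \<in> e" using rep[OF assms(1)] assms(2) by simp
  ultimately obtain t where "e = gain_equiv `` {t}" "(t, (u, v, \<gamma>)) \<in> gain_equiv"
    by (auto elim!: quotientE)
  then have "e = gain_equiv `` {(u, v, \<gamma>)}" using equiv_class_eq[OF equiv_gain_equiv] by metis
  then show ?thesis by (auto simp: gain_equiv_def)
qed

text \<open>The derivation is prescribed as the velocity on the coordinates of \<open>p\<close> and
  as 0 on the entries of \<open>L\<close>; the offsets, being integer combinations of these entries,
  are then killed too.\<close>

sublocale incidence_framework E inc "offset L" "\<chi> v. p v"
proof
  show "finite E" using gain_graph unfolding gain_graph_def by blast
  show "inc e v \<in> \<int>" for e v by (auto simp: incidence_def split: prod.split)
  show "(\<Sum>v\<in>UNIV. inc e v) = 0" for e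
    using sum_incidence[of e _ _ _ "\<lambda>_. 1 :: real"] by (cases "rep e") simp
  fix p' :: "real ^ 'd ^ 'v"
  let ?d = "case_sum (\<lambda>(v, i). p' $ v $ i) (\<lambda>_. 0)"
  obtain D where D: "derivation D" "\<And>k. D (framework_coords p L k) = ?d k"
    using algebraically_independent_derivation[of "framework_coords p L" ?d] generic
    unfolding generic_framework_def by blast
  have "D (p v $ i) = p' $ v $ i" for v i using D(2)[of "Inl (v, i)"] by simp
  moreover have "D (L $ i $ j) = 0" for i j using D(2)[of "Inr (i, j)"] by simp
  then have "D (offset L e $ i) = 0" for e i
    unfolding lattice_vec_nth by (simp add: derivation_sum[OF D(1)] derivation_mult[OF D(1)] derivation_Ints[OF D(1)])
  ultimately show "\<exists>D. derivation D \<and> map_vec2 D (\<chi> v. p v) = p' \<and> (\<forall>e\<in>E. \<forall>i. D (offset L e $ i) = 0)"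
    using D(1) by (intro exI[of _ D]) (simp add: vec_eq_iff)
qed

lemma equivalent_iff: "equivalent_frameworks E p L q L \<longleftrightarrow> same_lengths (\<chi> v. q v)"
proof -
  have "(\<forall>(u, v, \<gamma>)\<in>e. norm (p v + lattice_vec L \<gamma> - p u) = norm (q v + lattice_vec L \<gamma> - q u))
    \<longleftrightarrow> norm (edge_diff inc e (\<chi> v. q v) + offset L e) = norm (edge_diff inc e (\<chi> v. p v) + offset L e)"
    if e: "e \<in> E" for e
  proof -
    obtain u v \<gamma> where r: "rep e = (u, v, \<gamma>)" by (cases "rep e")
    have "norm (f u + lattice_vec L (- \<gamma>) - f v) = norm (f v + lattice_vec L \<gamma> - f u)"
      for f :: "'v \<Rightarrow> real ^ 'd"
      using norm_minus_cancel[of "f v + lattice_vec L \<gamma> - f u"] by (simp add: lattice_vec_uminus algebra_simps)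
    moreover have "edge_diff inc e (\<chi> v. f v) + offset L e = f v + lattice_vec L \<gamma> - f u"
      for f :: "'v \<Rightarrow> real ^ 'd"
      by (simp add: edge_diff_incidence[OF r] r)
    ultimately show ?thesis by (subst edge_eq[OF e r]) auto
  qed
  then show ?thesis unfolding equivalent_frameworks_def by blast
qed

lemma globally_rigid_iff:
  "fixed_lattice_globally_rigid E p L \<longleftrightarrow> (\<forall>q. same_lengths q \<longrightarrow> constant_vec (q - (\<chi> v. p v)))"
proof -
  have cong: "congruent_frameworks p L q L \<longleftrightarrow> constant_vec ((\<chi> v. q v) - (\<chi> v. p v))" for q
    unfolding congruent_same_lattice_iff[OF generic_lattice_invertible[OF generic]]
    by (simp add: algebra_simps)
  show ?thesis
    unfolding fixed_lattice_globally_rigid_def equivalent_iff cong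
  proof
    assume H: "\<forall>q. same_lengths (\<chi> v. q v) \<longrightarrow> constant_vec ((\<chi> v. q v) - (\<chi> v. p v))"
    show "\<forall>q. same_lengths q \<longrightarrow> constant_vec (q - (\<chi> v. p v))"
    proof
      fix q show "same_lengths q \<longrightarrow> constant_vec (q - (\<chi> v. p v))"
        using spec[OF H, of "($) q"] by (simp only: vec_lambda_eta)
    qed
  qed blast
qed

text \<open>The sign of the incidence entry absorbs the orientation: at either end of a non-loop
  edge, the vector in the definition is this entry times the edge vector of the
  representative.\<close>

lemma equilibrium_stress_iff:
  "fixed_lattice_equilibrium_stress E p L \<omega> \<longleftrightarrow> stress \<omega> (\<chi> v. p v)"
proof -
  have "(\<Sum>(u, \<gamma>)\<in>{(u, \<gamma>). u \<noteq> x \<and> (u, x, \<gamma>) \<in> e}. \<omega> e *\<^sub>R (p x + lattice_vec L \<gamma> - p u))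
    = (\<omega> e * inc e x) *\<^sub>R (edge_diff inc e (\<chi> v. p v) + offset L e)" if e: "e \<in> E" for e x
  proof -
    obtain u v \<gamma> where r: "rep e = (u, v, \<gamma>)" by (cases "rep e")
    let ?S = "{(u', \<gamma>'). u' \<noteq> x \<and> (u', x, \<gamma>') \<in> e}"
    have S: "?S = {(u', \<gamma>'). u' \<noteq> x \<and> ((u', x, \<gamma>') = (u, v, \<gamma>) \<or> (u', x, \<gamma>') = (v, u, - \<gamma>))}"
      unfolding edge_eq[OF e r] by blast
    consider "u = v \<or> x \<noteq> u \<and> x \<noteq> v" | "u \<noteq> v" "x = v" | "u \<noteq> v" "x = u" by blast
    then show ?thesis
    proof cases
      case 1
      then have S1: "?S = {}" unfolding S by auto
      show ?thesis unfolding S1 using 1 by (auto simp: r incidence_def)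
    next
      case 2
      then have S2: "?S = {(u, \<gamma>)}" unfolding S by auto
      show ?thesis unfolding S2 using 2
        by (simp add: r edge_diff_incidence[OF r] incidence_def algebra_simps)
    next
      case 3
      then have S3: "?S = {(v, - \<gamma>)}" unfolding S by auto
      show ?thesis unfolding S3 using 3
        by (simp add: r edge_diff_incidence[OF r] incidence_def lattice_vec_uminus algebra_simps)
    qed
  qed
  then have "fixed_lattice_equilibrium_stress E p L \<omega> \<longleftrightarrow>
      (\<forall>x. (\<Sum>e\<in>E. (\<omega> e * inc e x) *\<^sub>R (edge_diff inc e (\<chi> v. p v) + offset L e)) = 0)"
    unfolding fixed_lattice_equilibrium_stress_def by simp
  also have "\<dots> \<longleftrightarrow> (\<forall>x. (\<Lambda> \<omega> (\<chi> v. p v) + load E inc (offset L) \<omega>) $ x = 0)"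
    by (simp add: lap_def load_def scaleR_add_right sum.distrib)
  also have "\<dots> \<longleftrightarrow> stress \<omega> (\<chi> v. p v)"
    by (subst vec_eq_iff) simp
  finally show ?thesis .
qed

lemma laplacian_lap:
  "lap E inc \<omega> Z $ x $ i = (laplacian rep E \<omega> *v (\<chi> v. (Z :: real ^ 'd ^ 'v) $ v $ i)) $ x"
proof -
  have "lap E inc \<omega> Z $ x $ i = (\<Sum>e\<in>E. \<Sum>y\<in>UNIV. inc e x * \<omega> e * inc e y * Z $ y $ i)"
    by (simp add: lap_def edge_diff_def sum_distrib_left mult_ac)
  also have "\<dots> = (laplacian rep E \<omega> *v (\<chi> v. Z $ v $ i)) $ x"
    by (subst sum.swap) (simp add: laplacian_def matrix_vector_mult_def sum_distrib_right)
  finally show ?thesis .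
qed

text \<open>The all-ones vector is always in the kernel, so dimension 1 means that the kernel
  consists of the constants; \<open>lap\<close> tests this in every coordinate at once.\<close>

lemma laplacian_kernel_iff:
  "dim {z :: real ^ 'v. laplacian rep E \<omega> *v z = 0} = 1
    \<longleftrightarrow> (\<forall>Z :: real ^ 'd ^ 'v. lap E inc \<omega> Z = 0 \<longrightarrow> constant_vec Z)"
proof -
  define K where "K = {z :: real ^ 'v. laplacian rep E \<omega> *v z = 0}"
  have K: "subspace K"
    unfolding K_def by (intro linear_subspace_kernel matrix_vector_mul_linear)
  have lap_K: "lap E inc \<omega> Z = 0 \<longleftrightarrow> (\<forall>i. (\<chi> v. Z $ v $ i) \<in> K)" for Z :: "real ^ 'd ^ 'v"
    by (auto simp: K_def vec_eq_iff laplacian_lap)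
  have one: "1 \<in> K"
  proof -
    have "edge_diff inc e (1 :: real ^ 'd ^ 'v) = 0" for e
      by (rule edge_diff_constant) auto
    then have "lap E inc \<omega> (1 :: real ^ 'd ^ 'v) = 0"
      by (simp add: lap_def vec_eq_iff)
    moreover have "(\<chi> v. (1 :: real ^ 'd ^ 'v) $ v $ i) = 1" for i by (simp add: vec_eq_iff)
    ultimately show ?thesis unfolding lap_K by simp
  qed
  have span1: "span {1} = {z :: real ^ 'v. constant_vec z}"
  proof safe
    fix z :: "real ^ 'v" assume "z \<in> span {1}"
    then obtain c where "z = c *\<^sub>R 1" unfolding span_singleton by blast
    then show "constant_vec z" by simp
  next
    fix z :: "real ^ 'v" and c assume "\<forall>v. z $ v = c"
    then have "z = c *\<^sub>R 1" by (simp add: vec_eq_iff)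
    then show "z \<in> span {1}" unfolding span_singleton by blast
  qed
  have "(1 :: real ^ 'v) \<noteq> 0" by (simp add: vec_eq_iff)
  then have d1: "dim (span {1 :: real ^ 'v}) = 1" unfolding dim_span dim_singleton by simp
  have sub: "span {1} \<subseteq> K" using one by (intro span_minimal K) simp
  have "dim K = 1 \<longleftrightarrow> K = span {1}"
  proof
    assume "dim K = 1"
    then have "dim K \<le> dim (span {1 :: real ^ 'v})" using d1 by linarith
    from subspace_dim_equal[OF subspace_span K sub this] show "K = span {1}" ..
  next
    assume "K = span {1}"
    then show "dim K = 1" using d1 by metis
  qed
  also have "\<dots> \<longleftrightarrow> (\<forall>z\<in>K. constant_vec z)"
    using sub unfolding span1 by blast
  also have "\<dots> \<longleftrightarrow> (\<forall>Z :: real ^ 'd ^ 'v. lap E inc \<omega> Z = 0 \<longrightarrow> constant_vec Z)"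
  proof safe
    fix Z :: "real ^ 'd ^ 'v" assume K1: "\<forall>z\<in>K. constant_vec z" and "lap E inc \<omega> Z = 0"
    then have "\<forall>i. \<exists>x. \<forall>v. Z $ v $ i = x" unfolding lap_K by force
    then obtain x where "\<And>v i. Z $ v $ i = x i" by metis
    then show "constant_vec Z" by (intro exI[of _ "\<chi> i. x i"]) (simp add: vec_eq_iff)
  next
    fix z assume *: "\<forall>Z :: real ^ 'd ^ 'v. lap E inc \<omega> Z = 0 \<longrightarrow> constant_vec Z" and "z \<in> K"
    then have "lap E inc \<omega> ((\<chi> v i. z $ v) :: real ^ 'd ^ 'v) = 0" unfolding lap_K by simp
    then have "constant_vec ((\<chi> v i. z $ v) :: real ^ 'd ^ 'v)" using * by blast
    then show "constant_vec z" by (auto simp: vec_eq_iff)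
  qed
  finally show ?thesis unfolding K_def .
qed

text \<open>
  Since the kernel of the rigidity matrix is defined over the ring generated by the coordinates of
  the framework, an infinitesimal motion extends to a polynomial field of infinitesimal motions.
\<close>

lemma infinitesimally_rigid_of_globally_rigid:
  assumes glob: "\<And>q. same_lengths q \<Longrightarrow> constant_vec (q - (\<chi> v. p v))"
    and z: "\<And>e. e \<in> E \<Longrightarrow> rigidity_row inc (offset L) (\<chi> v. p v) e \<bullet> z = 0"
  shows "constant_vec z"
proof (rule ccontr)
  assume "\<not> constant_vec z"
  then obtain u v i where uv: "z $ u $ i \<noteq> z $ v $ i" by (metis vec_eq_iff)
  \<comment> \<open>Pinned at \<open>v\<close>, the motion has a nonzero entry at
    \<open>(u, i)\<close>.\<close>
  define z' where "z' = z - (\<chi> w. z $ v)"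
  have \<delta>z': "edge_diff inc e z' = edge_diff inc e z" for e
    unfolding z'_def edge_diff_diff by (subst edge_diff_constant[of "\<chi> v. _"]) auto
  define a0 where "a0 = framework_coords p L"
  have a0: "algebraically_independent_over_rat a0"
    using generic by (simp add: a0_def generic_framework_def)
  define R where "R e k a = rigidity_row inc (offset (\<chi> i j. a (Inr (i, j)))) (\<chi> v i. a (Inl (v, i))) e
    $ fst k $ snd k" for e k and a :: "('v \<times> 'd) + ('d \<times> 'd) \<Rightarrow> real"
  have R: "R e (w, j) (framework_coords q L) = rigidity_row inc (offset L) (\<chi> v. q v) e $ w $ j"
    for e w j q
    by (simp add: R_def)
  have inc_poly: "rat_poly_fun (\<lambda>a. inc e w)" for e w
    using inc_Ints[of e w] by (auto elim: Ints_cases)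
  have coords_p: "framework_coords (($) (\<chi> v. p v)) L = a0"
    by (simp add: a0_def framework_coords_def fun_eq_iff split: sum.split)
  have R_poly: "rat_poly_fun (R e k)" for e k
    unfolding R_def rigidity_row_def edge_diff_def
    by (auto simp: lattice_vec_nth intro!: rat_poly_fun_mult rat_poly_fun_add rat_poly_fun_sum inc_poly)
  \<comment> \<open>The ring generated over the rationals by the coordinates of \<open>p\<close> and
    \<open>L\<close>.\<close>
  define K where "K = {f a0 | f. rat_poly_fun f}"
  \<comment> \<open>The coordinates of configurations pinned at \<open>v\<close>, except
    \<open>(u, i)\<close>, which is split off as the one to keep nonzero.\<close>
  define J where "J = {(w, j). w \<noteq> v} - {(u, i)}"
  have uvJ: "insert (u, i) J = {(w, j). w \<noteq> v}" using uv unfolding J_def by auto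
  have row_sum: "rigidity_row inc (offset L) q e \<bullet> y =
      (\<Sum>k\<in>insert (u, i) J. R e k (framework_coords (($) q) L) * y $ fst k $ snd k)"
    if "y $ v = 0" for q e and y :: "real ^ 'd ^ 'v"
  proof -
    have "rigidity_row inc (offset L) q e \<bullet> y =
        (\<Sum>(w, j)\<in>UNIV. R e (w, j) (framework_coords (($) q) L) * y $ w $ j)"
      unfolding R by (simp add: inner_vec_def sum.cartesian_product)
    also have "\<dots> = (\<Sum>(w, j)\<in>insert (u, i) J. R e (w, j) (framework_coords (($) q) L) * y $ w $ j)"
      unfolding uvJ using that by (intro sum.mono_neutral_right) auto
    finally show ?thesis by (simp add: case_prod_beta)
  qed
  have "\<exists>y. (\<forall>k\<in>insert (u, i) J. y k \<in> K) \<and>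
      (\<forall>e\<in>E. (\<Sum>k\<in>insert (u, i) J. R e k a0 * y k) = 0) \<and> y (u, i) \<noteq> 0"
  proof (rule homogeneous_system_subring[where z = "\<lambda>k. z' $ fst k $ snd k"])
    show "1 \<in> K" unfolding K_def using rat_poly_fun_1 by (intro CollectI exI[of _ "\<lambda>_. 1"]) simp
    show "x - y \<in> K" if "x \<in> K" "y \<in> K" for x y
      using that rat_poly_fun_diff unfolding K_def by (smt (verit) mem_Collect_eq)
    show "x * y \<in> K" if "x \<in> K" "y \<in> K" for x y
      using that rat_poly_fun_mult unfolding K_def by (smt (verit) mem_Collect_eq)
    show "R e k a0 \<in> K" for e k using R_poly unfolding K_def by blast
    show "(\<Sum>k\<in>insert (u, i) J. R e k a0 * z' $ fst k $ snd k) = 0" if "e \<in> E" for e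
    proof -
      have "rigidity_row inc (offset L) (\<chi> v. p v) e \<bullet> z' = 0"
        using z[OF that] unfolding rigidity_row_inner \<delta>z' .
      moreover have "z' $ v = 0" by (simp add: z'_def)
      ultimately show ?thesis using row_sum[of z' "\<chi> v. p v" e] unfolding coords_p by simp
    qed
    show "z' $ fst (u, i) $ snd (u, i) \<noteq> 0" using uv by (simp add: z'_def)
  qed (auto simp: J_def)
  then obtain y where y: "\<And>k. k \<in> insert (u, i) J \<Longrightarrow> y k \<in> K"
    "\<And>e. e \<in> E \<Longrightarrow> (\<Sum>k\<in>insert (u, i) J. R e k a0 * y k) = 0" "y (u, i) \<noteq> 0"
    by blast
  have "\<exists>f. rat_poly_fun f \<and> (k \<in> insert (u, i) J \<longrightarrow> y k = f a0)" for k
    using y(1)[of k] rat_poly_fun_0 unfolding K_def by (cases "k \<in> insert (u, i) J") blast+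
  then obtain f where f: "\<And>k. rat_poly_fun (f k)" "\<And>k. k \<in> insert (u, i) J \<Longrightarrow> y k = f k a0"
    by metis
  \<comment> \<open>The ring elements \<open>y k\<close> are replaced by polynomials taking these
    values at \<open>a0\<close>, evaluated at a moving \<open>q\<close> with \<open>L\<close>
    unchanged.\<close>
  define \<zeta> where "\<zeta> q = (\<chi> w j. if w = v then 0 else f (w, j) (framework_coords (($) q) L))"
    for q :: "real ^ 'd ^ 'v"
  have "\<exists>q. same_lengths q \<and> \<not> constant_vec (q - (\<chi> v. p v))"
  proof (rule not_globally_rigid_of_flex[of \<zeta> v u i])
    show "continuous_on UNIV \<zeta>"
      unfolding \<zeta>_def
    proof (intro continuous_on_vec_lambda)
      show "continuous_on UNIV (\<lambda>q. if w = v then 0 else f (w, j) (framework_coords (($) q) L))" for w j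
        using continuous_on_rat_poly_fun[OF f(1)] by (cases "w = v") auto
    qed
    show "\<zeta> q $ v = 0" for q by (simp add: \<zeta>_def vec_eq_iff)
    show "\<zeta> (\<chi> v. p v) $ u $ i \<noteq> 0"
      using uv y(3) f(2)[of "(u, i)"] by (auto simp: \<zeta>_def coords_p)
    fix q e assume e: "e \<in> E"
    have "(\<Sum>k\<in>insert (u, i) J. R e k a0 * f k a0) = 0" using y(2)[OF e] f(2) by simp
    \<comment> \<open>A polynomial relation at the generic point \<open>a0\<close> holds
      identically.\<close>
    then have "(\<Sum>k\<in>insert (u, i) J. R e k a * f k a) = 0" for a
      by (rule rat_poly_fun_eq_0[OF a0, rotated]) (intro rat_poly_fun_sum rat_poly_fun_mult R_poly f(1))
    then show "rigidity_row inc (offset L) q e \<bullet> \<zeta> q = 0"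
      unfolding uvJ by (subst row_sum) (auto simp: \<zeta>_def uvJ vec_eq_iff case_prod_beta intro!: sum.cong)
  qed
  then show False using glob by blast
qed

lemma globally_rigid_iff_stress:
  "fixed_lattice_globally_rigid E p L \<longleftrightarrow>
    (\<exists>\<omega>. fixed_lattice_equilibrium_stress E p L \<omega> \<and>
         dim {z :: real ^ 'v. laplacian rep E \<omega> *v z = 0} = 1)"
  unfolding globally_rigid_iff equilibrium_stress_iff laplacian_kernel_iff
proof
  assume "\<forall>q. same_lengths q \<longrightarrow> constant_vec (q - (\<chi> v. p v))"
  then have glob: "constant_vec (q - (\<chi> v. p v))" if "same_lengths q" for q using that by blast
  have rigid: "constant_vec z" if "\<And>e. e \<in> E \<Longrightarrow> \<rho> e \<bullet> z = 0" for z
    using infinitesimally_rigid_of_globally_rigid[OF glob that] .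
  show "\<exists>\<omega>. stress \<omega> (\<chi> v. p v) \<and> (\<forall>Z :: real ^ 'd ^ 'v. \<Lambda> \<omega> Z = 0 \<longrightarrow> constant_vec Z)"
    by (rule stress_of_globally_rigid[OF rigid glob])
next
  assume "\<exists>\<omega>. stress \<omega> (\<chi> v. p v) \<and> (\<forall>Z :: real ^ 'd ^ 'v. \<Lambda> \<omega> Z = 0 \<longrightarrow> constant_vec Z)"
  then obtain \<omega> where \<omega>: "stress \<omega> (\<chi> v. p v)"
    "\<And>Z :: real ^ 'd ^ 'v. \<Lambda> \<omega> Z = 0 \<Longrightarrow> constant_vec Z"
    by metis
  show "\<forall>q. same_lengths q \<longrightarrow> constant_vec (q - (\<chi> v. p v))"
    using globally_rigid_of_stress[OF \<omega>] by simp
qed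

end

theorem theorem1p2:
  fixes E :: "('v::finite, 'd::finite) edge set"
    and rep :: "('v, 'd) edge \<Rightarrow> ('v, 'd) triple"
    and p :: "'v \<Rightarrow> real ^ 'd"
    and L :: "real ^ 'd ^ 'd"
  assumes "gain_graph E"
    and "\<And>e. e \<in> E \<Longrightarrow> rep e \<in> e"
    and "generic_framework p L"
  shows "fixed_lattice_globally_rigid E p L \<longleftrightarrow>
    (\<exists>\<omega>. fixed_lattice_equilibrium_stress E p L \<omega> \<and>
         dim {z :: real ^ 'v. laplacian rep E \<omega> *v z = 0} = 1)"
proof -
  interpret generic_gain_framework E rep p L using assms by unfold_locales
  show ?thesis by (rule globally_rigid_iff_stress)
qed

end
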